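(* Let $n\ge 2$. The separability complex $\mathrm{SC}(\mathbf{R}_n)$ of the rose $\mathbf{R}_n$ is nonhyperbolic, i.e. it is not a Gromov-hyperbolic metric space.
   Context: $\mathbf{F}_n$ is the free group on $X_n=\{x_1,\dots,x_n\}$, and $\mathbf{R}_n$ is the rose (graph with one vertex and $n$ edges), with $\pi_1(\mathbf{R}_n)$ identified with $\mathbf{F}_n$. A proper free factor of $\mathbf{F}_n$ is a nontrivial proper subgroup $F$ such that $\mathbf{F}_n=F*G$ for some nontrivial proper subgroup $G$. An element of $\mathbf{F}_n$ is separable if it lies in some proper free factor; $\mathcal{C}^{\mathrm{sep}}$ is the set of separable elements. The separability complex $\mathrm{SC}(\mathbf{R}_n)$ is the directed graph defined as follows. Its vertices are the conjugacy classes $[v]$ of elements $v\in\mathbf{F}_n$. Each edge is labeled by the conjugacy class $[\alpha]$ of a nontrivial element of $\mathcal{C}^{\mathrm{sep}}$; there is an edge labeled $[\alpha]$ from $[v]$ to $[w]$ whenever there are $\hat\alpha\in[\alpha]$, $\hat v\in[v]$, $\hat w\in[w]$ with $\hat w=\hat v\hat\alpha$ in $\mathbf{F}_n$. It is connected and carries the path metric (ignoring orientations) in which every edge has length one. Hyperbolic means that there is $\delta\geq 0$ such that each side of every geodesic triangle lies in the $\delta$-neighborhood of the union of the other two sides. *)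

theory Defs
  imports
    Complex_Main
    "HOL-Algebra.Group"
    "Graph_Theory.Digraph"
begin

section \<open>Free groups\<close>

text \<open>A letter is a generator (second component \<open>True\<close>) or the formal inverse of a generator
  (second component \<open>False\<close>). Elements of the free group are the reduced words.\<close>

type_synonym 'a letter = "'a \<times> bool"

definition inv_letter :: "'a letter \<Rightarrow> 'a letter" where
  "inv_letter a = (fst a, \<not> snd a)"

definition reduced :: "'a letter list \<Rightarrow> bool" where
  "reduced w \<longleftrightarrow> successively (\<lambda>a b. b \<noteq> inv_letter a) w"

fun cancel_cons :: "'a letter \<Rightarrow> 'a letter list \<Rightarrow> 'a letter list" where
  "cancel_cons a [] = [a]"
| "cancel_cons a (b # w) = (if b = inv_letter a then w else a # b # w)"

definition free_group :: "'a set \<Rightarrow> 'a letter list monoid" where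
  "free_group X =
    \<lparr>carrier = {w. reduced w \<and> fst ` set w \<subseteq> X}, mult = foldr cancel_cons, one = []\<rparr>"

lemma inv_letter_inv_letter [simp]: "inv_letter (inv_letter a) = a"
  by (simp add: inv_letter_def)

lemma fst_inv_letter [simp]: "fst (inv_letter a) = fst a"
  by (simp add: inv_letter_def)

lemma inv_letter_neq [simp]: "inv_letter a \<noteq> a" "a \<noteq> inv_letter a"
  by (auto simp: inv_letter_def prod_eq_iff)

lemma reduced_Nil [simp]: "reduced []"
  by (simp add: reduced_def)

lemma reduced_Cons: "reduced (a # w) \<longleftrightarrow> (w = [] \<or> hd w \<noteq> inv_letter a) \<and> reduced w"
  by (cases w) (auto simp: reduced_def)

lemma reduced_cancel_cons: "reduced w \<Longrightarrow> reduced (cancel_cons a w)"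
  by (cases w) (auto simp: reduced_Cons)

lemma cancel_cons_inv_letter: "reduced w \<Longrightarrow> cancel_cons a (cancel_cons (inv_letter a) w) = w"
  by (cases w) (auto simp: reduced_Cons neq_Nil_conv, metis cancel_cons.elims list.sel(1))

lemma reduced_foldr_cancel_cons: "reduced v \<Longrightarrow> reduced (foldr cancel_cons u v)"
  by (induction u) (auto intro: reduced_cancel_cons)

lemma set_cancel_cons: "set (cancel_cons a w) \<subseteq> insert a (set w)"
  by (cases w) auto

lemma set_foldr_cancel_cons: "set (foldr cancel_cons u v) \<subseteq> set u \<union> set v"
  by (induction u) (use set_cancel_cons in fastforce)+

lemma foldr_cancel_cons_cancel_cons:
  assumes "reduced w"
  shows "foldr cancel_cons (cancel_cons a x) w = cancel_cons a (foldr cancel_cons x w)"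
proof (cases x)
  case (Cons b y)
  then show ?thesis
    using cancel_cons_inv_letter[OF reduced_foldr_cancel_cons[OF assms], of a y] by auto
qed simp

lemma foldr_cancel_cons_assoc:
  assumes "reduced w"
  shows "foldr cancel_cons (foldr cancel_cons u v) w = foldr cancel_cons u (foldr cancel_cons v w)"
  by (induction u) (simp_all add: foldr_cancel_cons_cancel_cons[OF assms])

lemma foldr_cancel_cons_inverse: "foldr cancel_cons (rev (map inv_letter u)) (u @ v) = v"
  by (induction u) simp_all

lemma reduced_rev_inv_letter: "reduced w \<Longrightarrow> reduced (rev (map inv_letter w))"
  unfolding reduced_def successively_rev successively_map
  by (erule successively_mono) (metis inv_letter_inv_letter)

lemma group_free_group: "group (free_group X)"
proof (rule groupI)
  fix u v w
  assume u: "u \<in> carrier (free_group X)" and v: "v \<in> carrier (free_group X)"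
    and w: "w \<in> carrier (free_group X)"
  have "fst ` set (foldr cancel_cons u v) \<subseteq> fst ` set u \<union> fst ` set v"
    unfolding image_Un[symmetric] by (rule image_mono) (rule set_foldr_cancel_cons)
  also have "\<dots> \<subseteq> X"
    using u v by (simp add: free_group_def)
  finally show "u \<otimes>\<^bsub>free_group X\<^esub> v \<in> carrier (free_group X)"
    using v by (simp add: free_group_def reduced_foldr_cancel_cons)
  show "u \<otimes>\<^bsub>free_group X\<^esub> v \<otimes>\<^bsub>free_group X\<^esub> w
      = u \<otimes>\<^bsub>free_group X\<^esub> (v \<otimes>\<^bsub>free_group X\<^esub> w)"
    using w by (simp add: free_group_def foldr_cancel_cons_assoc)
next
  fix w assume w: "w \<in> carrier (free_group X)"
  show "\<one>\<^bsub>free_group X\<^esub> \<otimes>\<^bsub>free_group X\<^esub> w = w"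
    by (simp add: free_group_def)
  have "rev (map inv_letter w) \<in> carrier (free_group X)"
    using w by (auto simp: free_group_def reduced_rev_inv_letter image_image)
  moreover have "rev (map inv_letter w) \<otimes>\<^bsub>free_group X\<^esub> w = \<one>\<^bsub>free_group X\<^esub>"
    using foldr_cancel_cons_inverse[of w "[]"] by (simp add: free_group_def)
  ultimately show "\<exists>y\<in>carrier (free_group X). y \<otimes>\<^bsub>free_group X\<^esub> w = \<one>\<^bsub>free_group X\<^esub>"
    by blast
qed (auto simp: free_group_def)

text \<open>The free group of rank \<open>n\<close>, i.e. the fundamental group of the rose with \<open>n\<close> edges.\<close>

definition rose_group :: "nat \<Rightarrow> nat letter list monoid" where
  "rose_group n = free_group {1..n}"


section \<open>Free factors and separable elements\<close>

text \<open>Elements of the (external) free product \<open>A * B\<close> of two subgroups of \<open>G\<close> are the alternating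
  words in nontrivial elements of \<open>A\<close> (tag \<open>True\<close>) and of \<open>B\<close> (tag \<open>False\<close>). The tags keep the two
  factors disjoint, whether or not \<open>A\<close> and \<open>B\<close> meet in \<open>G\<close>. \<open>G = A * B\<close> means that the canonical
  homomorphism from the external free product to \<open>G\<close>, which multiplies out such a word, is
  bijective.\<close>

definition free_product_words :: "('a, 'm) monoid_scheme \<Rightarrow> 'a set \<Rightarrow> 'a set \<Rightarrow> (bool \<times> 'a) list set"
  where "free_product_words G A B =
    {ws. (\<forall>(c, g)\<in>set ws. g \<noteq> \<one>\<^bsub>G\<^esub> \<and> g \<in> (if c then A else B)) \<and>
         successively (\<lambda>x y. fst x \<noteq> fst y) ws}"

definition is_free_product :: "('a, 'm) monoid_scheme \<Rightarrow> 'a set \<Rightarrow> 'a set \<Rightarrow> bool" where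
  "is_free_product G A B \<longleftrightarrow> subgroup A G \<and> subgroup B G \<and>
    bij_betw (\<lambda>ws. foldr (\<lambda>x y. snd x \<otimes>\<^bsub>G\<^esub> y) ws \<one>\<^bsub>G\<^esub>) (free_product_words G A B) (carrier G)"

definition nontrivial_proper_subgroup :: "('a, 'm) monoid_scheme \<Rightarrow> 'a set \<Rightarrow> bool" where
  "nontrivial_proper_subgroup G A \<longleftrightarrow> subgroup A G \<and> A \<noteq> {\<one>\<^bsub>G\<^esub>} \<and> A \<noteq> carrier G"

definition proper_free_factor :: "('a, 'm) monoid_scheme \<Rightarrow> 'a set \<Rightarrow> bool" where
  "proper_free_factor G A \<longleftrightarrow> nontrivial_proper_subgroup G A \<and>
    (\<exists>B. nontrivial_proper_subgroup G B \<and> is_free_product G A B)"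

definition separable :: "('a, 'm) monoid_scheme \<Rightarrow> 'a \<Rightarrow> bool" where
  "separable G g \<longleftrightarrow> (\<exists>A. proper_free_factor G A \<and> g \<in> A)"


section \<open>The separability complex as a directed graph\<close>

definition conj_class :: "('a, 'm) monoid_scheme \<Rightarrow> 'a \<Rightarrow> 'a set" where
  "conj_class G g = {h \<otimes>\<^bsub>G\<^esub> g \<otimes>\<^bsub>G\<^esub> inv\<^bsub>G\<^esub> h | h. h \<in> carrier G}"

text \<open>An edge is a triple (source, label, target); so there is one edge for each label
  \<open>[\<alpha>]\<close> that occurs from \<open>[v]\<close> to \<open>[w]\<close>.\<close>

definition sep_complex ::
    "('a, 'm) monoid_scheme \<Rightarrow> ('a set, 'a set \<times> 'a set \<times> 'a set) pre_digraph" where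
  "sep_complex G =
    \<lparr>verts = conj_class G ` carrier G,
     arcs = {(V, L, W). V \<in> conj_class G ` carrier G \<and> W \<in> conj_class G ` carrier G \<and>
       L \<in> conj_class G ` {\<alpha> \<in> carrier G. separable G \<alpha> \<and> \<alpha> \<noteq> \<one>\<^bsub>G\<^esub>} \<and>
       (\<exists>v\<in>V. \<exists>\<alpha>\<in>L. \<exists>w\<in>W. w = v \<otimes>\<^bsub>G\<^esub> \<alpha>)},
     tail = fst,
     head = snd \<circ> snd\<rparr>"

lemma wf_digraph_sep_complex: "wf_digraph (sep_complex G)"
  by unfold_locales (auto simp: sep_complex_def)

definition SC :: "nat \<Rightarrow>
    (nat letter list set, nat letter list set \<times> nat letter list set \<times> nat letter list set) pre_digraph"
  where "SC n = sep_complex (rose_group n)"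


section \<open>The path metric on a graph\<close>

text \<open>Each edge \<open>e\<close> is realized as a copy of the unit interval, with \<open>0\<close> glued to the tail of \<open>e\<close> and
  \<open>1\<close> glued to its head.\<close>

datatype ('v, 'e) graph_point = Vertex 'v | Inner 'e real

definition edge_point :: "('v, 'e) pre_digraph \<Rightarrow> 'e \<Rightarrow> real \<Rightarrow> ('v, 'e) graph_point" where
  "edge_point D e t =
    (if t \<le> 0 then Vertex (tail D e) else if t \<ge> 1 then Vertex (head D e) else Inner e t)"

definition graph_points :: "('v, 'e) pre_digraph \<Rightarrow> ('v, 'e) graph_point set" where
  "graph_points D = Vertex ` verts D \<union> {edge_point D e t | e t. e \<in> arcs D \<and> t \<in> {0..1}}"

text \<open>\<open>graph_path D p l q\<close>: some path from \<open>p\<close> to \<open>q\<close>, a finite concatenation of segments each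
  contained in a single edge and run through in either direction, has length \<open>l\<close>.\<close>

inductive graph_path ::
    "('v, 'e) pre_digraph \<Rightarrow> ('v, 'e) graph_point \<Rightarrow> real \<Rightarrow> ('v, 'e) graph_point \<Rightarrow> bool"
  for D :: "('v, 'e) pre_digraph" and p :: "('v, 'e) graph_point" where
  start: "p \<in> graph_points D \<Longrightarrow> graph_path D p 0 p"
| step: "graph_path D p l (edge_point D e s) \<Longrightarrow> e \<in> arcs D \<Longrightarrow> s \<in> {0..1} \<Longrightarrow> t \<in> {0..1} \<Longrightarrow>
    graph_path D p (l + \<bar>s - t\<bar>) (edge_point D e t)"

definition path_dist ::
    "('v, 'e) pre_digraph \<Rightarrow> ('v, 'e) graph_point \<Rightarrow> ('v, 'e) graph_point \<Rightarrow> real" where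
  "path_dist D p q = Inf {l. graph_path D p l q}"


section \<open>Gromov hyperbolicity\<close>

definition geodesic_segment :: "'a set \<Rightarrow> ('a \<Rightarrow> 'a \<Rightarrow> real) \<Rightarrow> 'a \<Rightarrow> 'a \<Rightarrow> 'a set \<Rightarrow> bool" where
  "geodesic_segment M d x y S \<longleftrightarrow> S \<subseteq> M \<and>
    (\<exists>g L. L \<ge> 0 \<and> g 0 = x \<and> g L = y \<and> S = g ` {0..L} \<and>
      (\<forall>s\<in>{0..L}. \<forall>t\<in>{0..L}. d (g s) (g t) = \<bar>s - t\<bar>))"

definition in_nbhd :: "('a \<Rightarrow> 'a \<Rightarrow> real) \<Rightarrow> real \<Rightarrow> 'a set \<Rightarrow> 'a set \<Rightarrow> bool" where
  "in_nbhd d \<delta> S T \<longleftrightarrow> (\<forall>p\<in>S. \<exists>q\<in>T. d p q \<le> \<delta>)"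

definition gromov_hyperbolic :: "'a set \<Rightarrow> ('a \<Rightarrow> 'a \<Rightarrow> real) \<Rightarrow> bool" where
  "gromov_hyperbolic M d \<longleftrightarrow> (\<exists>\<delta>\<ge>0. \<forall>x y z S1 S2 S3.
    geodesic_segment M d x y S1 \<and> geodesic_segment M d y z S2 \<and> geodesic_segment M d z x S3 \<longrightarrow>
      in_nbhd d \<delta> S1 (S2 \<union> S3) \<and> in_nbhd d \<delta> S2 (S3 \<union> S1) \<and> in_nbhd d \<delta> S3 (S1 \<union> S2))"

end

(* The complex contains a coarsely embedded quarter-plane. For a positive word u that contains
   every product of two generators, the Brooks counting function "occurrences of u minus
   occurrences of u^-1" is a quasimorphism, hence almost constant on conjugacy classes. It is bounded
   on separable elements, because a cyclically reduced separable word does not contain u: this is an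
   easy case of Whitehead's cut vertex lemma. It is therefore coarsely Lipschitz on the complex. For
   two such words u, v whose powers do not contain each other, the classes [u^i v^j] form a coarse
   quarter-plane, which cannot exist in a hyperbolic space.

   The cut vertex lemma: a splitting F = A * B divides F into the words whose normal form starts in A
   and the others, a partition with finite coboundary in the Cayley tree. The two ends of a line along
   the powers of an element of A lie on the same side. If the cyclic word of the element contains all
   positive pairs, these lines connect, below each vertex of the tree, the branches of positive
   letters with those of negative letters, so the partition is trivial outside a finite set. But
   both sides are infinite. *)
theory Submission
  imports Defs "HOL-Real_Asymp.Real_Asymp"
begin

section \<open>Hyperbolic spaces contain no coarse quarter-plane\<close>

text \<open>An edge may multiply by a separable element of any length and may change representatives
  at both ends, so word length says nothing about distance. What survives is a function that is
  bounded on all separable elements, almost additive and almost invariant under conjugation: its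
  change along an edge is bounded. A single such function only measures one direction, so two
  independent ones serve as coarse coordinates. Counting functions of positive words suit this.
  Positive words never cancel, so u^i v^j can be handled as a plain list, and a word that contains
  all positive pairs meets the hypothesis of the cut vertex argument directly, without Whitehead
  graphs. The two words share their list of pairs and are told apart by a long run of one generator
  in front of it. Two generators enter twice: they give two such words, and below each vertex of the
  tree they leave a branch of either sign that does not cancel with the letter leading
  there.\<close>

lemma geodesic_segment_sym:
  assumes "geodesic_segment M d x y S"
  shows "geodesic_segment M d y x S"
proof -
  obtain g L where g: "L \<ge> 0" "g 0 = x" "g L = y" "S = g ` {0..L}" "S \<subseteq> M"
    "\<forall>s\<in>{0..L}. \<forall>t\<in>{0..L}. d (g s) (g t) = \<bar>s - t\<bar>"
    using assms unfolding geodesic_segment_def by metis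
  have "(\<lambda>t. g (L - t)) ` {0..L} = g ` ((\<lambda>t. L - t) ` {0..L})"
    by (rule image_image[symmetric])
  also have "(\<lambda>t. L - t) ` {0..L} = {0..L}"
    by simp
  finally have "S = (\<lambda>t. g (L - t)) ` {0..L}"
    using g by simp
  then show ?thesis
    unfolding geodesic_segment_def
    using g by (intro conjI exI[of _ "\<lambda>t. g (L - t)"] exI[of _ L]) auto
qed

lemma geodesic_segment_endpoints:
  assumes "geodesic_segment M d x y S"
  shows "x \<in> M" "y \<in> M"
  using assms unfolding geodesic_segment_def by fastforce+

text \<open>Bisect the chain: a thin triangle moves the point, at cost \<open>\<delta>\<close>, to a
  geodesic over one of the halves. After \<open>m\<close> bisections a single step of the chain is
  left, hence the logarithmic bound. Powers of two keep the halving exact.\<close>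

lemma hyperbolic_geodesic_near_chain:
  fixes d :: "'a \<Rightarrow> 'a \<Rightarrow> real" and c :: "nat \<Rightarrow> 'a"
  assumes thin: "\<And>x y z S1 S2 S3. geodesic_segment M d x y S1 \<Longrightarrow> geodesic_segment M d y z S2 \<Longrightarrow>
      geodesic_segment M d z x S3 \<Longrightarrow> in_nbhd d \<delta> S1 (S2 \<union> S3)"
    and tri: "\<And>x y z. x \<in> M \<Longrightarrow> y \<in> M \<Longrightarrow> z \<in> M \<Longrightarrow> d x z \<le> d x y + d y z"
    and geo: "\<And>i j. \<exists>S. geodesic_segment M d (c i) (c j) S"
    and step: "\<And>i. d (c i) (c (Suc i)) \<le> K"
  shows "geodesic_segment M d (c a) (c (a + 2 ^ m)) S \<Longrightarrow> p \<in> S \<Longrightarrow>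
    \<exists>i\<in>{a..a + 2 ^ m}. d p (c i) \<le> \<delta> * m + K"
proof (induction m arbitrary: a S p)
  case 0
  then obtain g L where g: "L \<ge> 0" "g 0 = c a" "g L = c (Suc a)" "S = g ` {0..L}"
    "\<forall>s\<in>{0..L}. \<forall>t\<in>{0..L}. d (g s) (g t) = \<bar>s - t\<bar>"
    unfolding geodesic_segment_def by auto
  obtain t where t: "t \<in> {0..L}" "p = g t" using 0 g by auto
  have "d (g 0) (g L) = L" "d (g t) (g L) = L - t"
    using g(1) t(1) g(5)[rule_format, of 0 L] g(5)[rule_format, of t L] by simp_all
  then have "d p (c (Suc a)) \<le> K" using step[of a] g t by simp
  then show ?case by (intro bexI[of _ "Suc a"]) auto
next
  case (Suc m)
  let ?b = "a + 2 ^ m" let ?c = "?b + 2 ^ m"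
  have e: "a + 2 ^ Suc m = ?c" by simp
  obtain S2 where S2: "geodesic_segment M d (c ?b) (c ?c) S2" using geo[of ?b ?c] by blast
  obtain S3 where S3: "geodesic_segment M d (c a) (c ?b) S3" using geo[of a ?b] by blast
  have "in_nbhd d \<delta> S (S2 \<union> S3)"
    using Suc.prems(1) unfolding e
    by (rule thin[OF _ geodesic_segment_sym[OF S2] geodesic_segment_sym[OF S3]])
  then obtain q where q: "q \<in> S2 \<union> S3" "d p q \<le> \<delta>"
    using Suc.prems unfolding in_nbhd_def by blast
  have "\<exists>i\<in>{a..a + 2 ^ Suc m}. d q (c i) \<le> \<delta> * m + K"
    using q(1)
  proof
    assume "q \<in> S2"
    from Suc.IH[OF S2 this] show ?thesis by auto
  next
    assume "q \<in> S3"
    from Suc.IH[OF S3 this] show ?thesis by force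
  qed
  then obtain i where i: "i \<in> {a..a + 2 ^ Suc m}" "d q (c i) \<le> \<delta> * m + K" by blast
  have "p \<in> M" "q \<in> M"
    using Suc.prems S2 S3 q unfolding geodesic_segment_def by auto
  moreover have "c i \<in> M"
    by (rule exE[OF geo[of i i]]) (rule geodesic_segment_endpoints(1))
  ultimately have "d p (c i) \<le> d p q + d q (c i)" by (intro tri)
  also have "\<dots> \<le> \<delta> * Suc m + K" using q i by (simp add: algebra_simps)
  finally show ?case using i by blast
qed

lemma chain_dist_le:
  fixes d :: "'a \<Rightarrow> 'a \<Rightarrow> real" and c :: "nat \<Rightarrow> 'a"
  assumes tri: "\<And>i j k. d (c i) (c k) \<le> d (c i) (c j) + d (c j) (c k)"
    and zero: "\<And>i. d (c i) (c i) = 0"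
    and step: "\<And>i. d (c i) (c (Suc i)) \<le> K"
  shows "d (c a) (c (a + k)) \<le> K * k"
proof (induction k)
  case (Suc k)
  then show ?case
    using tri[of a "a + Suc k" "a + k"] step[of "a + k"] by (simp add: algebra_simps)
qed (simp add: zero)

text \<open>The two ways around the boundary of a large square in a quarter-plane are chains with common
  ends that stay linearly far apart, whereas both come logarithmically close to the midpoint of a
  geodesic.\<close>

lemma quarter_plane_not_hyperbolic:
  fixes d :: "'a \<Rightarrow> 'a \<Rightarrow> real" and P :: "nat \<Rightarrow> nat \<Rightarrow> 'a"
  assumes sym: "\<And>x y. x \<in> M \<Longrightarrow> y \<in> M \<Longrightarrow> d x y = d y x"
    and tri: "\<And>x y z. x \<in> M \<Longrightarrow> y \<in> M \<Longrightarrow> z \<in> M \<Longrightarrow> d x z \<le> d x y + d y z"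
    and geo: "\<And>i j k l. \<exists>S. geodesic_segment M d (P i j) (P k l) S"
    and step1: "\<And>i j. d (P i j) (P (Suc i) j) \<le> K" and step2: "\<And>i j. d (P i j) (P i (Suc j)) \<le> K"
    and lower1: "\<And>i j k l. \<bar>real i - real k\<bar> \<le> C * d (P i j) (P k l) + C"
    and lower2: "\<And>i j k l. \<bar>real j - real l\<bar> \<le> C * d (P i j) (P k l) + C"
    and nonneg: "K \<ge> 0" "C \<ge> 0"
  shows "\<not> gromov_hyperbolic M d"
proof
  assume "gromov_hyperbolic M d"
  then obtain \<delta> where \<delta>: "\<delta> \<ge> 0" and thin: "\<And>x y z S1 S2 S3. geodesic_segment M d x y S1 \<Longrightarrow>
      geodesic_segment M d y z S2 \<Longrightarrow> geodesic_segment M d z x S3 \<Longrightarrow> in_nbhd d \<delta> S1 (S2 \<union> S3)"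
    unfolding gromov_hyperbolic_def by metis
  \<comment> \<open>A side of the square has \<open>2 ^ m\<close> steps, so a boundary chain has
    \<open>2 ^ Suc m\<close>; this is the bound after \<open>Suc m\<close> bisections.\<close>
  define E where "E m = \<delta> * (real m + 1) + K" for m
  have bound: "2 ^ m \<le> 2 * C * (K * (2 * C * E m + C) + E m) + C" for m
  proof -
    define N where "N = (2::nat) ^ m"
    \<comment> \<open>Truncated subtraction keeps the second coordinate of \<open>c1\<close> at 0
      until the corner \<open>P N 0\<close>; \<open>c2\<close> goes round by the opposite
      corner.\<close>
    define c1 where "c1 i = P (min i N) (i - N)" for i
    define c2 where "c2 i = P (i - N) (min i N)" for i
    have inM: "P i j \<in> M" for i j
      by (rule exE[OF geo[of i j i j]]) (rule geodesic_segment_endpoints(1))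
    then have cM: "c1 i \<in> M" "c2 i \<in> M" for i by (auto simp: c1_def c2_def)
    have zero: "d (P i j) (P i j) = 0" for i j
    proof -
      obtain S where "geodesic_segment M d (P i j) (P i j) S" using geo[of i j i j] by blast
      then obtain g L where "L \<ge> 0" "g 0 = P i j"
        and g: "\<forall>s\<in>{0..L::real}. \<forall>t\<in>{0..L}. d (g s) (g t) = \<bar>s - t\<bar>"
        unfolding geodesic_segment_def by auto
      then show ?thesis using g[rule_format, of 0 0] by simp
    qed
    have c1_step: "d (c1 i) (c1 (Suc i)) \<le> K" for i
      using step1 step2 nonneg unfolding c1_def
      by (cases "i < N") (auto simp: min_def Suc_diff_le not_less le_Suc_eq)
    have c2_step: "d (c2 i) (c2 (Suc i)) \<le> K" for i
      using step1 step2 nonneg unfolding c2_def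
      by (cases "i < N") (auto simp: min_def Suc_diff_le not_less le_Suc_eq)
    have ends: "c1 0 = P 0 0" "c2 0 = P 0 0" "c1 (2 * N) = P N N" "c2 (2 * N) = P N N"
      by (auto simp: c1_def c2_def)
    have N2: "2 * N = 0 + 2 ^ Suc m" by (simp add: N_def)
    obtain S where S: "geodesic_segment M d (P 0 0) (P N N) S" using geo[of 0 0 N N] by blast
    then obtain g L where g: "L \<ge> 0" "g 0 = P 0 0" "g L = P N N" "S = g ` {0..L}" "S \<subseteq> M"
      "\<forall>s\<in>{0..L}. \<forall>t\<in>{0..L}. d (g s) (g t) = \<bar>s - t\<bar>"
      unfolding geodesic_segment_def by metis
    define p where "p = g (L / 2)"
    have p: "p \<in> S" "p \<in> M" "d (P 0 0) p = L / 2" "d p (P N N) = L / 2" "d (P 0 0) (P N N) = L"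
      using g(1,4,5) g(6)[rule_format, of 0 "L / 2"] g(6)[rule_format, of "L / 2" L]
        g(6)[rule_format, of 0 L]
      unfolding p_def by (auto simp: g(2,3))
    have S1: "geodesic_segment M d (c1 0) (c1 (0 + 2 ^ Suc m)) S"
      and S2: "geodesic_segment M d (c2 0) (c2 (0 + 2 ^ Suc m)) S"
      using S by (simp_all only: ends flip: N2)
    have "\<exists>i\<in>{0..0 + 2 ^ Suc m}. d p (c1 i) \<le> \<delta> * Suc m + K"
      by (rule hyperbolic_geodesic_near_chain[where M = M, OF _ _ _ _ S1])
        (use thin tri geo c1_step p in \<open>auto simp: c1_def\<close>)
    then obtain i where i: "i \<le> 2 * N" "d p (c1 i) \<le> E m"
      unfolding E_def N_def by (auto simp: add.commute)
    have "\<exists>i\<in>{0..0 + 2 ^ Suc m}. d p (c2 i) \<le> \<delta> * Suc m + K"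
      by (rule hyperbolic_geodesic_near_chain[where M = M, OF _ _ _ _ S2])
        (use thin tri geo c2_step p in \<open>auto simp: c2_def\<close>)
    then obtain j where j: "j \<le> 2 * N" "d p (c2 j) \<le> E m"
      unfolding E_def N_def by (auto simp: add.commute)
    have "d (c1 i) (c2 j) \<le> d (c1 i) p + d p (c2 j)"
      by (intro tri cM p)
    then have close: "d (c1 i) (c2 j) \<le> 2 * E m"
      using i j sym[OF cM(1)[of i] p(2)] by simp
    have c1_le: "d (c1 a) (c1 (a + k)) \<le> K * k" for a k
      using cM zero c1_step by (intro chain_dist_le tri) (auto simp: c1_def)
    have c2_le: "d (c2 a) (c2 (a + k)) \<le> K * k" for a k
      using cM zero c2_step by (intro chain_dist_le tri) (auto simp: c2_def)
    \<comment> \<open>A point within \<open>E m\<close> of the midpoint is at least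
      \<open>L / 2 - E m\<close> away from both ends, so its index is not small, counted from either
      end.\<close>
    have far: "L / 2 - E m \<le> K * i" "L / 2 - E m \<le> K * (2 * N - i)"
      "L / 2 - E m \<le> K * j" "L / 2 - E m \<le> K * (2 * N - j)"
    proof -
      have "d (P 0 0) p \<le> d (c1 0) (c1 i) + d (c1 i) p" "d p (P N N)
          \<le> d p (c1 i) + d (c1 i) (c1 (2 * N))"
        "d (P 0 0) p \<le> d (c2 0) (c2 j) + d (c2 j) p" "d p (P N N)
            \<le> d p (c2 j) + d (c2 j) (c2 (2 * N))"
        unfolding ends by (auto intro!: tri cM inM p)
      moreover have "d (c1 i) p = d p (c1 i)" "d (c2 j) p = d p (c2 j)"
        using sym cM p by auto
      moreover have "d (c1 0) (c1 i) \<le> K * i" "d (c2 0) (c2 j) \<le> K * j"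
        "d (c1 i) (c1 (2 * N)) \<le> K * (2 * N - i)" "d (c2 j) (c2 (2 * N)) \<le> K * (2 * N - j)"
        using c1_le[of 0 i] c2_le[of 0 j] c1_le[of i "2 * N - i"] c2_le[of j "2 * N - j"] i j
        by (auto simp: of_nat_diff)
      ultimately show "L / 2 - E m \<le> K * i" "L / 2 - E m \<le> K * (2 * N - i)"
        "L / 2 - E m \<le> K * j" "L / 2 - E m \<le> K * (2 * N - j)"
        using p i j by linarith+
    qed
    have dC: "C * d (c1 i) (c2 j) \<le> C * (2 * E m)"
      using close nonneg by (intro mult_left_mono)
    \<comment> \<open>\<open>t\<close> is an index distance to an end of the chains that is visible
      in one coordinate of the two close points. Before both corners it is \<open>i\<close>, after
      both it is \<open>2 * N - j\<close>. In the mixed cases the points lie on opposite sides of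
      the square and differ by the full \<open>N\<close>.\<close>
    have "\<exists>t. L / 2 - E m \<le> K * t \<and> t \<le> 2 * C * E m + C"
    proof (cases "i \<le> N"; cases "j \<le> N")
      assume "i \<le> N" "j \<le> N"
      then show ?thesis
        using lower1[of i 0 0 j] dC far by (intro exI[of _ "real i"]) (auto simp: c1_def c2_def)
    next
      assume *: "i \<le> N" "\<not> j \<le> N"
      have "real i \<le> real N" using * by simp
      then show ?thesis
        using lower2[of 0 N i "j - N"] dC far * by (intro exI[of _ "real i"]) (auto simp: c1_def
          c2_def)
    next
      assume *: "\<not> i \<le> N" "j \<le> N"
      have "real j \<le> real N" using * by simp
      then show ?thesis
        using lower1[of N 0 "i - N" j] dC far * by (intro exI[of _ "real j"]) (auto simp: c1_def
          c2_def)
    next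
      assume *: "\<not> i \<le> N" "\<not> j \<le> N"
      then show ?thesis
        using lower1[of N "j - N" "i - N" N] dC far j
        by (intro exI[of _ "2 * real N - real j"]) (auto simp: c1_def c2_def of_nat_diff)
    qed
    then obtain t where t: "L / 2 - E m \<le> K * t" "t \<le> 2 * C * E m + C" by blast
    have "K * t \<le> K * (2 * C * E m + C)" using t nonneg by (intro mult_left_mono)
    with t(1) have "L / 2 - E m \<le> K * (2 * C * E m + C)" by (rule order_trans)
    moreover have "L \<le> 2 * (X + E m)" if "L / 2 - E m \<le> X" for X using that by simp
    ultimately have "L \<le> 2 * (K * (2 * C * E m + C) + E m)" by blast
    then have "C * L \<le> C * (2 * (K * (2 * C * E m + C) + E m))"
      using nonneg by (intro mult_left_mono)
    \<comment> \<open>The coordinates make the diagonal length \<open>L\<close> at least linear in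
      \<open>N = 2 ^ m\<close>, whereas the preceding bound on \<open>L\<close> is linear in
      \<open>m\<close>.\<close>
    moreover have "real N \<le> C * L + C" using lower1[of 0 N 0 N] p by simp
    ultimately show ?thesis by (simp add: N_def algebra_simps)
  qed
  define A B where "A = 2 * C * (K * 2 * C * \<delta> + \<delta>)"
    and "B = 2 * C * (K * (2 * C * (\<delta> + K) + C) + \<delta> + K) + C"
  have "2 ^ m \<le> A * m + B" for m
    using bound[of m] unfolding E_def A_def B_def by (simp add: algebra_simps)
  moreover have "eventually (\<lambda>m. A * real m + B < 2 ^ m) sequentially"
    by real_asymp
  ultimately show False
    using eventually_happens'[OF sequentially_bot] by (fastforce simp: not_less[symmetric])
qed


section \<open>Geodesics in connected graphs\<close>

definition adjacent :: "('v, 'e) pre_digraph \<Rightarrow> 'v \<Rightarrow> 'v \<Rightarrow> bool" where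
  "adjacent D u v \<longleftrightarrow> (\<exists>e\<in>arcs D. tail D e = u \<and> head D e = v \<or> tail D e = v \<and> head D e = u)"

definition vertex_dist :: "('v, 'e) pre_digraph \<Rightarrow> 'v \<Rightarrow> 'v \<Rightarrow> nat" where
  "vertex_dist D u v = (LEAST k. (adjacent D ^^ k) u v)"

lemma graph_path_points:
  assumes "graph_path D p l q"
  shows "p \<in> graph_points D" "q \<in> graph_points D" "l \<ge> 0"
  using assms by (induction rule: graph_path.induct) (auto simp: graph_points_def)

lemma graph_path_trans:
  assumes "graph_path D p l q" "graph_path D q l' r"
  shows "graph_path D p (l + l') r"
  using assms(2)
proof (induction rule: graph_path.induct)
  case start
  then show ?case using assms(1) by simp
next
  case (step l' e s t)
  then show ?case using graph_path.step[of D p "l + l'" e s t] by (simp add: add.assoc)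
qed

lemma graph_path_edge:
  assumes "e \<in> arcs D" "s \<in> {0..1}" "t \<in> {0..1}"
  shows "graph_path D (edge_point D e s) \<bar>s - t\<bar> (edge_point D e t)"
proof -
  have "edge_point D e s \<in> graph_points D" using assms by (auto simp: graph_points_def)
  from graph_path.step[OF graph_path.start[OF this] assms] show ?thesis by simp
qed

lemma graph_path_sym: "graph_path D p l q \<Longrightarrow> graph_path D q l p"
proof (induction rule: graph_path.induct)
  case (step l e s t)
  then show ?case
    using graph_path_trans[OF graph_path_edge[of e D t s] step.IH]
    by (simp add: abs_minus_commute add.commute)
qed (rule graph_path.start)

locale connected_graph = wf_digraph D for D :: "('v, 'e) pre_digraph" +
  assumes connected: "u \<in> verts D \<Longrightarrow> v \<in> verts D \<Longrightarrow> \<exists>k. (adjacent D ^^ k) u v"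
begin

lemma adjacent_verts: "adjacent D u v \<Longrightarrow> u \<in> verts D \<and> v \<in> verts D"
  by (auto simp: adjacent_def)

lemma adjacent_sym: "adjacent D u v \<Longrightarrow> adjacent D v u"
  by (auto simp: adjacent_def)

lemma adjacent_pow_vertex_dist:
  assumes "u \<in> verts D" "v \<in> verts D"
  shows "(adjacent D ^^ vertex_dist D u v) u v"
  unfolding vertex_dist_def using connected[OF assms] by (rule LeastI_ex)

lemma vertex_dist_le: "(adjacent D ^^ k) u v \<Longrightarrow> vertex_dist D u v \<le> k"
  unfolding vertex_dist_def by (rule Least_le)

lemma vertex_dist_adjacent:
  assumes "u \<in> verts D" "adjacent D v w"
  shows "vertex_dist D u w \<le> vertex_dist D u v + 1"
proof -
  have "(adjacent D ^^ Suc (vertex_dist D u v)) u w"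
    using adjacent_pow_vertex_dist[of u v] assms adjacent_verts[of v w]
      by (auto intro: relpowp_Suc_I)
  then show ?thesis using vertex_dist_le by fastforce
qed

lemma vertex_dist_refl: "vertex_dist D u u = 0"
  using vertex_dist_le[of 0 u u] by simp

lemma graph_path_adjacent_pow:
  "(adjacent D ^^ k) u v \<Longrightarrow> u \<in> verts D \<Longrightarrow> graph_path D (Vertex u) (real k) (Vertex v)"
proof (induction k arbitrary: v)
  case 0
  then show ?case by (auto simp: graph_points_def intro: graph_path.start)
next
  case (Suc k)
  then obtain w where w: "(adjacent D ^^ k) u w" "adjacent D w v" by (auto elim: relpowp_Suc_E)
  then obtain e where e: "e \<in> arcs D" "tail D e = w \<and> head D e = v \<or> tail D e = v \<and> head D e = w"
    by (auto simp: adjacent_def)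
  have "graph_path D (Vertex w) 1 (Vertex v)"
    using graph_path_edge[OF e(1), of 0 1] graph_path_edge[OF e(1), of 1 0] e(2)
    by (auto simp: edge_point_def)
  from graph_path_trans[OF Suc.IH[OF w(1) Suc.prems(2)] this] show ?case
    by (simp add: add.commute)
qed

lemma graph_path_vertex:
  assumes "p \<in> graph_points D"
  obtains v l where "v \<in> verts D" "graph_path D p l (Vertex v)"
  using assms unfolding graph_points_def
proof (elim UnE)
  assume "p \<in> Vertex ` verts D"
  then show ?thesis using that graph_path.start[of p D] by (auto simp: graph_points_def)
next
  assume "p \<in> {edge_point D e t |e t. e \<in> arcs D \<and> t \<in> {0..1}}"
  then obtain e t where "p = edge_point D e t" "e \<in> arcs D" "t \<in> {0..1}" by blast
  then show ?thesis
    using that[of "tail D e" "\<bar>t - 0\<bar>"] graph_path_edge[of e D t 0] by (auto simp: edge_point_def)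
qed

lemma graph_path_exists:
  assumes "p \<in> graph_points D" "q \<in> graph_points D"
  shows "\<exists>l. graph_path D p l q"
proof -
  obtain u k where u: "u \<in> verts D" "graph_path D p k (Vertex u)"
    using graph_path_vertex[OF assms(1)] .
  obtain v l where v: "v \<in> verts D" "graph_path D q l (Vertex v)"
    using graph_path_vertex[OF assms(2)] .
  have "graph_path D (Vertex u) (vertex_dist D u v) (Vertex v)"
    using u v adjacent_pow_vertex_dist graph_path_adjacent_pow by blast
  then show ?thesis
    using u(2) graph_path_sym[OF v(2)] graph_path_trans by blast
qed

lemma path_dist_le: "graph_path D p l q \<Longrightarrow> path_dist D p q \<le> l"
  unfolding path_dist_def
  by (rule cInf_lower) (auto intro!: bdd_belowI[of _ 0] dest: graph_path_points(3))

lemma path_dist_sym: "path_dist D p q = path_dist D q p"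
proof -
  have "{l. graph_path D p l q} = {l. graph_path D q l p}" using graph_path_sym by blast
  then show ?thesis by (simp add: path_dist_def)
qed

lemma path_dist_approx:
  assumes "p \<in> graph_points D" "q \<in> graph_points D" "\<epsilon> > 0"
  shows "\<exists>l. graph_path D p l q \<and> l < path_dist D p q + \<epsilon>"
  using cInf_lessD[of "{l. graph_path D p l q}" "path_dist D p q + \<epsilon>"] graph_path_exists[OF
    assms(1,2)] assms(3)
  unfolding path_dist_def by auto

lemma path_dist_triangle:
  assumes "p \<in> graph_points D" "q \<in> graph_points D" "r \<in> graph_points D"
  shows "path_dist D p r \<le> path_dist D p q + path_dist D q r"
proof (rule field_le_epsilon)
  fix \<epsilon> :: real assume "\<epsilon> > 0"
  then have "\<epsilon> / 2 > 0" by simp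
  obtain k where k: "graph_path D p k q" "k < path_dist D p q + \<epsilon> / 2"
    using path_dist_approx[OF assms(1,2) \<open>\<epsilon> / 2 > 0\<close>] by blast
  obtain l where l: "graph_path D q l r" "l < path_dist D q r + \<epsilon> / 2"
    using path_dist_approx[OF assms(2,3) \<open>\<epsilon> / 2 > 0\<close>] by blast
  have "path_dist D p r \<le> k + l" using k l by (intro path_dist_le graph_path_trans)
  then show "path_dist D p r \<le> path_dist D p q + path_dist D q r + \<epsilon>" using k l by linarith
qed

text \<open>Intended as the distance from \<open>Vertex u\<close>: an inner point is reached through
  one of the two ends of its edge. Paths may turn inside edges, so a lower bound on their lengths
  needs a 1-Lipschitz function on all points, not only on vertices.\<close>

definition height :: "'v \<Rightarrow> ('v, 'e) graph_point \<Rightarrow> real" where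
  "height u p = (case p of Vertex v \<Rightarrow> vertex_dist D u v
    | Inner e t \<Rightarrow> min (real (vertex_dist D u (tail D e)) + t) (real (vertex_dist D u (head D e)) +
      (1 - t)))"

text \<open>The formula for inner points extends to the ends because \<open>vertex_dist\<close>
  changes by at most one along an edge, so going round by the other end is never shorter.\<close>

lemma height_edge_point:
  assumes "u \<in> verts D" "e \<in> arcs D" "t \<in> {0..1}"
  shows "height u (edge_point D e t)
    = min (real (vertex_dist D u (tail D e)) + t) (real (vertex_dist D u (head D e)) + (1 - t))"
proof -
  have "adjacent D (tail D e) (head D e)" using assms by (auto simp: adjacent_def)
  then have "real (vertex_dist D u (head D e)) \<le> real (vertex_dist D u (tail D e)) + 1"
    "real (vertex_dist D u (tail D e)) \<le> real (vertex_dist D u (head D e)) + 1"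
    using vertex_dist_adjacent[OF assms(1), of "tail D e" "head D e"]
      vertex_dist_adjacent[OF assms(1), of "head D e" "tail D e"] adjacent_sym by force+
  then show ?thesis
    using assms(3) by (auto simp: height_def edge_point_def)
qed

lemma height_graph_path:
  assumes "u \<in> verts D" "graph_path D p l q"
  shows "\<bar>height u p - height u q\<bar> \<le> l"
  using assms(2)
proof (induction rule: graph_path.induct)
  case (step l e s t)
  have "\<bar>height u (edge_point D e s) - height u (edge_point D e t)\<bar> \<le> \<bar>s - t\<bar>"
    using step.hyps unfolding height_edge_point[OF assms(1) step.hyps(2,3)] height_edge_point[OF
      assms(1) step.hyps(2,4)]
    by (auto simp: min_def abs_real_def)
  then show ?case using step.IH by linarith
qed simp

lemma path_dist_vertices:
  assumes "u \<in> verts D" "v \<in> verts D"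
  shows "path_dist D (Vertex u) (Vertex v) = vertex_dist D u v"
proof (rule antisym)
  show "path_dist D (Vertex u) (Vertex v) \<le> vertex_dist D u v"
    using assms adjacent_pow_vertex_dist graph_path_adjacent_pow path_dist_le by blast
  have "{l. graph_path D (Vertex u) l (Vertex v)} \<noteq> {}"
    using assms graph_path_exists by (auto simp: graph_points_def)
  then show "vertex_dist D u v \<le> path_dist D (Vertex u) (Vertex v)"
    unfolding path_dist_def
  proof (rule cInf_greatest)
    fix l assume "l \<in> {l. graph_path D (Vertex u) l (Vertex v)}"
    then show "vertex_dist D u v \<le> l"
      using height_graph_path[OF assms(1), of "Vertex u" l "Vertex v"]
        by (simp add: height_def vertex_dist_refl)
  qed
qed

text \<open>Only an upper bound is claimed, so edges can be appended one at a time, whether or not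
  the edge path is a shortest one.\<close>

lemma short_path_exists:
  assumes "(adjacent D ^^ k) u v" "u \<in> verts D"
  shows "\<exists>g. g 0 = Vertex u \<and> g (real k) = Vertex v \<and> g ` {0..real k} \<subseteq> graph_points D \<and>
    (\<forall>s\<in>{0..real k}. \<forall>t\<in>{0..real k}. path_dist D (g s) (g t) \<le> \<bar>s - t\<bar>)"
  using assms(1)
proof (induction k arbitrary: v)
  case 0
  have p: "Vertex u \<in> graph_points D" using assms(2) by (auto simp: graph_points_def)
  then have "path_dist D (Vertex u) (Vertex u) \<le> 0" by (intro path_dist_le graph_path.start)
  then show ?case using 0 p by (intro exI[of _ "\<lambda>_. Vertex u"]) auto
next
  case (Suc k)
  then obtain w where w: "(adjacent D ^^ k) u w" "adjacent D w v" by (auto elim: relpowp_Suc_E)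
  then obtain e where e: "e \<in> arcs D" "tail D e = w \<and> head D e = v \<or> tail D e = v \<and> head D e = w"
    by (auto simp: adjacent_def)
  define h where "h t = edge_point D e (if tail D e = w \<and> head D e = v then t else 1 - t)" for t
  have h: "h 0 = Vertex w" "h 1 = Vertex v" using e by (auto simp: h_def edge_point_def)
  have "edge_point D e t \<in> graph_points D" if "t \<in> {0..1}" for t
    using that e(1) unfolding graph_points_def by blast
  then have hM: "h t \<in> graph_points D" if "t \<in> {0..1}" for t
    using that unfolding h_def by simp
  have h1: "path_dist D (h s) (h t) \<le> \<bar>s - t\<bar>" if "s \<in> {0..1}" "t \<in> {0..1}" for s t
    using that graph_path_edge[OF e(1), of s t] graph_path_edge[OF e(1), of "1 - s" "1 - t"]
    unfolding h_def by (auto intro!: path_dist_le simp: abs_minus_commute)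
  obtain g where g: "g 0 = Vertex u" "g (real k) = Vertex w" "g ` {0..real k} \<subseteq> graph_points D"
    "\<And>s t. s \<in> {0..real k} \<Longrightarrow> t \<in> {0..real k} \<Longrightarrow> path_dist D (g s) (g t) \<le> \<bar>s - t\<bar>"
    using Suc.IH[OF w(1)] by auto
  define f where "f t = (if t \<le> real k then g t else h (t - k))" for t
  have f: "f 0 = Vertex u" "f (real (Suc k)) = Vertex v" using g h by (auto simp: f_def)
  have fM: "f t \<in> graph_points D" if "t \<in> {0..real (Suc k)}" for t
    using that g(3) hM[of "t - k"] by (auto simp: f_def)
  have mono: "path_dist D (f s) (f t) \<le> \<bar>s - t\<bar>"
    if "s \<in> {0..real (Suc k)}" "t \<in> {0..real (Suc k)}" "s \<le> t" for s t
  proof -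
    consider "t \<le> real k" | "s > real k" | "s \<le> real k" "t > real k" by linarith
    then show ?thesis
    proof cases
      case 3
      have "path_dist D (f s) (f t) \<le> path_dist D (g s) (g k) + path_dist D (h 0) (h (t - k))"
        unfolding f_def g(2) h(1)[symmetric]
        using 3 that g(3) hM[of "t - k"] hM[of 0] by (auto intro!: path_dist_triangle)
      also have "\<dots> \<le> \<bar>s - k\<bar> + \<bar>0 - (t - k)\<bar>"
        using 3 that by (intro add_mono g h1) auto
      finally show ?thesis using 3 by simp
    qed (use that g(4)[of s t] h1[of "s - k" "t - k"] in \<open>auto simp: f_def\<close>)
  qed
  have "path_dist D (f s) (f t) \<le> \<bar>s - t\<bar>" if "s \<in> {0..real (Suc k)}" "t \<in> {0..real (Suc k)}"
    for s t
    using mono[of s t] mono[of t s] that path_dist_sym[of "f s" "f t"]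
    by (cases "s \<le> t") (auto simp: abs_minus_commute)
  then show ?case using f fM by (intro exI[of _ f]) blast
qed

text \<open>A 1-Lipschitz path whose length equals the distance of its ends is isometric: a shortcut
  anywhere would bring the ends closer.\<close>

lemma vertex_geodesic_exists:
  assumes "u \<in> verts D" "v \<in> verts D"
  shows "\<exists>S. geodesic_segment (graph_points D) (path_dist D) (Vertex u) (Vertex v) S"
proof -
  define k where "k = real (vertex_dist D u v)"
  obtain g where g: "g 0 = Vertex u" "g k = Vertex v" "g ` {0..k} \<subseteq> graph_points D"
    "\<And>s t. s \<in> {0..k} \<Longrightarrow> t \<in> {0..k} \<Longrightarrow> path_dist D (g s) (g t) \<le> \<bar>s - t\<bar>"
    using short_path_exists[OF adjacent_pow_vertex_dist[OF assms] assms(1)] unfolding k_def by blast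
  have k: "path_dist D (g 0) (g k) = k"
    unfolding g(1,2) using path_dist_vertices[OF assms] by (simp add: k_def)
  have k0: "k \<ge> 0" by (simp add: k_def)
  have mono: "path_dist D (g s) (g t) = \<bar>s - t\<bar>" if "s \<in> {0..k}" "t \<in> {0..k}" "s \<le> t" for s t
  proof -
    have "path_dist D (g 0) (g k) \<le> path_dist D (g 0) (g s) + path_dist D (g s) (g k)"
      "path_dist D (g s) (g k) \<le> path_dist D (g s) (g t) + path_dist D (g t) (g k)"
      using that g(3) k0 by (auto intro!: path_dist_triangle)
    then show ?thesis
      using g(4)[of 0 s] g(4)[of s t] g(4)[of t k] that k0 unfolding k by auto
  qed
  have "path_dist D (g s) (g t) = \<bar>s - t\<bar>" if "s \<in> {0..k}" "t \<in> {0..k}" for s t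
    using mono[of s t] mono[of t s] that path_dist_sym[of "g s" "g t"]
    by (cases "s \<le> t") (auto simp: abs_minus_commute)
  then show ?thesis
    unfolding geodesic_segment_def using g k0 by (intro exI[of _ "g ` {0..k}"]) blast
qed

end


section \<open>Words and counting quasimorphisms\<close>

definition word_inv :: "'a letter list \<Rightarrow> 'a letter list" where
  "word_inv w = rev (map inv_letter w)"

lemma word_inv_simps [simp]:
  "word_inv [] = []" "word_inv (a # v) = word_inv v @ [inv_letter a]"
  "word_inv (v @ w) = word_inv w @ word_inv v" "word_inv (word_inv w) = w"
  "length (word_inv w) = length w" "fst ` set (word_inv w) = fst ` set w"
  by (auto simp: word_inv_def rev_map image_image o_def)

lemma word_inv_eq_Nil [simp]: "word_inv w = [] \<longleftrightarrow> w = []"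
  by (simp add: word_inv_def)

lemma reduced_word_inv [simp]: "reduced (word_inv w) \<longleftrightarrow> reduced w"
  using reduced_rev_inv_letter[of w] reduced_rev_inv_letter[of "word_inv w"]
  by (auto simp: word_inv_def[symmetric])

lemma reduced_append:
  "reduced (v @ w) \<longleftrightarrow> reduced v \<and> reduced w \<and> (v \<noteq> [] \<longrightarrow> w \<noteq> [] \<longrightarrow> hd w \<noteq> inv_letter (last v))"
  unfolding reduced_def successively_append_iff by auto

lemma reduced_overlap: "reduced (u @ v) \<Longrightarrow> reduced (v @ w) \<Longrightarrow> v \<noteq> [] \<Longrightarrow> reduced (u @ v @ w)"
  by (auto simp: reduced_append)

lemma foldr_cancel_cons_reduced: "reduced (v @ w) \<Longrightarrow> foldr cancel_cons v w = v @ w"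
proof (induction v)
  case (Cons a v)
  then show ?case by (cases "v @ w") (auto simp: reduced_Cons)
qed simp

text \<open>The cancelled piece \<open>c\<close> occurs in \<open>v\<close> and inverted in
  \<open>w\<close>. An antisymmetric function sees these contributions cancel, which is how counting
  functions become quasimorphisms.\<close>

lemma foldr_cancel_cons_split:
  "reduced v \<Longrightarrow> reduced w \<Longrightarrow>
    \<exists>a b c. v = a @ c \<and> w = word_inv c @ b \<and> foldr cancel_cons v w = a @ b"
proof (induction v)
  case Nil
  then show ?case by simp
next
  case (Cons x v)
  then obtain a b c where abc: "v = a @ c" "w = word_inv c @ b" "foldr cancel_cons v w = a @ b"
    by (auto simp: reduced_Cons)
  show ?case
  proof (cases "a = [] \<and> b \<noteq> [] \<and> hd b = inv_letter x")
    \<comment> \<open>The new letter can cancel against \<open>b\<close> only when \<open>a\<close>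
      is empty; then the cancelled piece grows by that letter.\<close>
    case True
    then have "x # v = [] @ (x # c)" "w = word_inv (x # c) @ tl b"
      "foldr cancel_cons (x # v) w = [] @ tl b"
      using abc by (cases b; auto)+
    then show ?thesis by blast
  next
    case False
    have "a \<noteq> [] \<Longrightarrow> hd a \<noteq> inv_letter x" using Cons.prems abc by (auto simp: reduced_Cons)
    then have "a @ b = [] \<or> hd (a @ b) \<noteq> inv_letter x"
      using False by (auto simp: hd_append)
    then have "cancel_cons x (a @ b) = x # a @ b" by (cases "a @ b") auto
    then have "foldr cancel_cons (x # v) w = (x # a) @ b" using abc(3) by simp
    then show ?thesis using abc by (metis append_Cons)
  qed
qed

lemma carrier_free_group: "w \<in> carrier (free_group X) \<longleftrightarrow> reduced w \<and> fst ` set w \<subseteq> X"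
  by (simp add: free_group_def)

lemma mult_free_group: "v \<otimes>\<^bsub>free_group X\<^esub> w = foldr cancel_cons v w"
  by (simp add: free_group_def)

lemma one_free_group: "\<one>\<^bsub>free_group X\<^esub> = []"
  by (simp add: free_group_def)

lemma mult_free_group_reduced:
  "reduced (v @ w) \<Longrightarrow> v \<otimes>\<^bsub>free_group X\<^esub> w = v @ w"
  by (simp add: mult_free_group foldr_cancel_cons_reduced)

lemma inv_free_group:
  assumes "w \<in> carrier (free_group X)"
  shows "inv\<^bsub>free_group X\<^esub> w = word_inv w"
proof (rule group.inv_equality[OF group_free_group])
  show "word_inv w \<otimes>\<^bsub>free_group X\<^esub> w = \<one>\<^bsub>free_group X\<^esub>"
    using foldr_cancel_cons_inverse[of w "[]"]
      by (simp add: mult_free_group one_free_group word_inv_def)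
qed (use assms in \<open>simp_all add: carrier_free_group\<close>)

section \<open>Counting functions as quasimorphisms\<close>

definition occurrences :: "'a list \<Rightarrow> 'a list \<Rightarrow> nat" where
  "occurrences u v = card {(p, s). v = p @ u @ s}"

lemma finite_occurrences: "finite {(p, s). v = p @ u @ s}"
proof (rule finite_subset)
  show "{(p, s). v = p @ u @ s} \<subseteq> (\<lambda>i. (take i v, drop (i + length u) v)) ` {..length v}"
  proof
    fix x assume "x \<in> {(p, s). v = p @ u @ s}"
    then obtain p s where "x = (p, s)" "v = p @ u @ s" by auto
    then show "x \<in> (\<lambda>i. (take i v, drop (i + length u) v)) ` {..length v}"
      by (intro image_eqI[of _ _ "length p"]) simp_all
  qed
qed simp

lemma occurrences_Nil: "u \<noteq> [] \<Longrightarrow> occurrences u [] = 0"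
  by (simp add: occurrences_def)

lemma occurrences_Cons:
  assumes "u \<noteq> []"
  shows "occurrences u (a # v) = (if \<exists>s. a # v = u @ s then 1 else 0) + occurrences u v"
proof -
  let ?A = "{(p, s). a # v = p @ u @ s \<and> p = []}"
  let ?B = "(\<lambda>(p, s). (a # p, s)) ` {(p, s). v = p @ u @ s}"
  have "{(p, s). a # v = p @ u @ s} = ?A \<union> ?B"
    by (auto simp: Cons_eq_append_conv image_iff)
  moreover have "?A \<inter> ?B = {}" by auto
  moreover have "finite ?A" by (rule finite_subset[OF _ finite_occurrences[of "a # v" u]]) auto
  ultimately have "occurrences u (a # v) = card ?A + card ?B"
    unfolding occurrences_def using finite_occurrences[of v u] by (simp add: card_Un_disjoint)
  moreover have "card ?B = occurrences u v"
    unfolding occurrences_def by (rule card_image) (auto simp: inj_on_def)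
  moreover have "card ?A = (if \<exists>s. a # v = u @ s then 1 else 0)"
  proof (cases "\<exists>s. a # v = u @ s")
    case True
    then obtain s where "a # v = u @ s" by blast
    then have "?A = {([], s)}" by auto
    then show ?thesis using True by simp
  next
    case False
    then have "?A = {}" by auto
    then show ?thesis using False by (simp del: Collect_empty_eq)
  qed
  ultimately show ?thesis by simp
qed

lemma occurrences_append_ge:
  assumes "u \<noteq> []"
  shows "occurrences u v + occurrences u w \<le> occurrences u (v @ w)"
proof (induction v)
  case (Cons a v)
  have "\<exists>s. a # v = u @ s \<Longrightarrow> \<exists>s. a # v @ w = u @ s" by (metis append_Cons append_assoc)
  then show ?case using Cons by (auto simp: occurrences_Cons[OF assms] split: if_splits)
qed (simp add: occurrences_Nil assms)

text \<open>An occurrence that lies in neither factor straddles the cut, so it starts among the last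
  letters of \<open>v\<close>, fewer than \<open>length u\<close> of them.\<close>

lemma occurrences_append_le:
  assumes "u \<noteq> []"
  shows "occurrences u (v @ w) \<le> occurrences u v + occurrences u w + length u"
proof -
  \<comment> \<open>The \<open>min\<close> carries the induction: a new straddling occurrence starts
    at \<open>a\<close> only while \<open>a # v\<close> is shorter than \<open>u\<close>, and then
    the \<open>min\<close> grows by one.\<close>
  have "occurrences u (v @ w) \<le> occurrences u v + occurrences u w + min (length u) (length v)"
  proof (induction v)
    case (Cons a v)
    show ?case
    proof (cases "(\<exists>s. a # v @ w = u @ s) \<and> \<not> (\<exists>s. a # v = u @ s)")
      case True
      then obtain s where s: "(a # v) @ w = u @ s" by auto
      have "length (a # v) < length u"
      proof (rule ccontr)
        assume "\<not> length (a # v) < length u"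
        then have "a # v = u @ drop (length u) (a # v)"
          using s by (metis append_eq_conv_conj append_take_drop_id not_less take_append
            take_all_iff diff_is_0_eq append_Nil2 take_eq_Nil)
        then show False using True by blast
      qed
      then show ?thesis using Cons by (auto simp: occurrences_Cons[OF assms] split: if_splits)
    qed (use Cons in \<open>auto simp: occurrences_Cons[OF assms] split: if_splits\<close>)
  qed simp
  then show ?thesis by simp
qed

lemma occurrences_word_inv: "occurrences (word_inv u) (word_inv v) = occurrences u v"
proof -
  have "bij_betw (\<lambda>(p, s). (word_inv s, word_inv p)) {(p, s). v = p @ u @ s}
      {(p, s). word_inv v = p @ word_inv u @ s}"
  proof (rule bij_betw_byWitness[where f' = "\<lambda>(p, s). (word_inv s, word_inv p)"])
    have "v = word_inv s @ u @ word_inv p" if "word_inv v = p @ word_inv u @ s" for p s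
    proof -
      have "v = word_inv (word_inv v)" by simp
      also have "\<dots> = word_inv s @ u @ word_inv p" unfolding that by simp
      finally show ?thesis .
    qed
    then show "(\<lambda>(p, s). (word_inv s, word_inv p)) ` {(p, s). word_inv v = p @ word_inv u @ s}
        \<subseteq> {(p, s). v = p @ u @ s}"
      by auto
  qed auto
  then show ?thesis unfolding occurrences_def by (rule bij_betw_same_card[symmetric])
qed

lemma occurrences_eq_0: "\<nexists>p s. v = p @ u @ s \<Longrightarrow> occurrences u v = 0"
  by (simp add: occurrences_def)

definition counting :: "'a letter list \<Rightarrow> 'a letter list \<Rightarrow> int" where
  "counting u v = int (occurrences u v) - int (occurrences (word_inv u) v)"

lemma counting_word_inv: "counting u (word_inv v) = - counting u v"
  using occurrences_word_inv[of u v] occurrences_word_inv[of "word_inv u" v]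
  by (simp add: counting_def)

text \<open>Both counts exceed the sum over the factors by something between 0 and
  \<open>length u\<close>, and the difference of two such defects is no larger.\<close>

lemma counting_append:
  assumes "u \<noteq> []"
  shows "\<bar>counting u (v @ w) - counting u v - counting u w\<bar> \<le> length u"
  using occurrences_append_ge[of u v w] occurrences_append_ge[of "word_inv u" v w]
    occurrences_append_le[of u v w] occurrences_append_le[of "word_inv u" v w] assms
  unfolding counting_def by simp

text \<open>One defect \<open>length u\<close> for each of the concatenations \<open>a @ c\<close>,
  \<open>word_inv c @ b\<close> and \<open>a @ b\<close>; the contributions of \<open>c\<close>
  cancel by antisymmetry.\<close>

lemma counting_mult:
  assumes "u \<noteq> []" "v \<in> carrier (free_group X)" "w \<in> carrier (free_group X)"
  shows "\<bar>counting u (v \<otimes>\<^bsub>free_group X\<^esub> w) - counting u v - counting u w\<bar> \<le> 3 * length u"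
proof -
  obtain a b c where abc: "v = a @ c" "w = word_inv c @ b" "v \<otimes>\<^bsub>free_group X\<^esub> w = a @ b"
    using foldr_cancel_cons_split[of v w] assms by (auto simp: carrier_free_group mult_free_group)
  then show ?thesis
    using counting_append[OF assms(1), of a c] counting_append[OF assms(1), of "word_inv c" b]
      counting_append[OF assms(1), of a b] counting_word_inv[of u c] by simp
qed

text \<open>Each of the two products costs \<open>3 * length u\<close>, and the contributions of
  \<open>h\<close> and its inverse cancel. So the count is almost a function of the conjugacy
  class.\<close>

lemma counting_conj:
  assumes "u \<noteq> []" "h \<in> carrier (free_group X)" "g \<in> carrier (free_group X)"
  shows "\<bar>counting u (h \<otimes>\<^bsub>free_group X\<^esub> g \<otimes>\<^bsub>free_group X\<^esub> inv\<^bsub>free_group X\<^esub> h) - counting u g\<bar>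
    \<le> 6 * length u"
proof -
  interpret group "free_group X" by (rule group_free_group)
  show ?thesis
    using counting_mult[OF assms] counting_mult[OF assms(1) m_closed[OF assms(2,3)] inv_closed[OF
      assms(2)]]
      counting_word_inv[of u h] inv_free_group[OF assms(2)] by simp
qed

section \<open>Cyclic reduction and powers\<close>

definition cyclically_reduced :: "'a letter list \<Rightarrow> bool" where
  "cyclically_reduced w \<longleftrightarrow> reduced w \<and> (w \<noteq> [] \<longrightarrow> hd w \<noteq> inv_letter (last w))"

lemma cyclically_reduced_word_inv:
  assumes "cyclically_reduced w"
  shows "cyclically_reduced (word_inv w)"
proof (cases "w = []")
  case False
  then have "hd (word_inv w) = inv_letter (last w)" "last (word_inv w) = inv_letter (hd w)"
    by (auto simp: word_inv_def hd_rev last_rev last_map hd_map)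
  then show ?thesis using assms False unfolding cyclically_reduced_def
    by (metis inv_letter_inv_letter reduced_word_inv)
qed (use assms in simp)

lemma cyclic_reduction:
  "reduced v \<Longrightarrow> \<exists>h w. v = h @ w @ word_inv h \<and> cyclically_reduced w \<and> (v \<noteq> [] \<longrightarrow> w \<noteq> [])"
proof (induction v rule: length_induct)
  case (1 v)
  show ?case
  proof (cases "cyclically_reduced v")
    case True
    then show ?thesis by (intro exI[of _ "[]"] exI[of _ v]) auto
  next
    case False
    then have v: "v \<noteq> []" "hd v = inv_letter (last v)"
      using 1 unfolding cyclically_reduced_def by auto
    define x where "x = hd v"
    obtain u where u: "v = x # u" using v(1) unfolding x_def by (cases v) auto
    have "u \<noteq> []" using v(2) unfolding u by auto
    then obtain y z where yz: "u = y @ [z]" by (cases u rule: rev_cases) auto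
    have "z = inv_letter x" using v(2) unfolding u yz by simp
    with u yz have y: "v = x # y @ [inv_letter x]" by simp
    have "reduced y" using 1(2) unfolding y by (auto simp: reduced_append reduced_Cons)
    moreover have "length y < length v" using y by simp
    ultimately obtain h w where hw: "y = h @ w @ word_inv h" "cyclically_reduced w" "y \<noteq> [] \<longrightarrow> w
        \<noteq> []"
      using 1(1) by blast
    have "y \<noteq> []" using 1(2) unfolding y by (auto simp: reduced_Cons)
    moreover have "v = (x # h) @ w @ word_inv (x # h)" by (simp add: y hw(1))
    ultimately show ?thesis using hw(2,3) by blast
  qed
qed

abbreviation word_pow :: "'a list \<Rightarrow> nat \<Rightarrow> 'a list" where
  "word_pow w k \<equiv> concat (replicate k w)"

lemma word_pow_Suc': "word_pow w (Suc k) = word_pow w k @ w"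
  by (induction k) simp_all

lemma length_word_pow: "length (word_pow w k) = k * length w"
  by (induction k) auto

lemma reduced_word_pow: "cyclically_reduced w \<Longrightarrow> reduced (word_pow w k)"
proof (induction k)
  case (Suc k)
  then show ?case
    by (cases k; cases "w = []") (auto simp: reduced_append cyclically_reduced_def hd_append)
qed simp


section \<open>The ends of a free product\<close>

abbreviation (in monoid) word_product :: "(bool \<times> 'a) list \<Rightarrow> 'a" where
  "word_product ws \<equiv> foldr (\<lambda>x y. snd x \<otimes> y) ws \<one>"

lemma (in monoid) word_product_closed:
  "snd ` set ws \<subseteq> carrier G \<Longrightarrow> word_product ws \<in> carrier G"
  by (induction ws) auto

lemma (in monoid) word_product_append:
  "snd ` set ws \<subseteq> carrier G \<Longrightarrow> snd ` set vs \<subseteq> carrier G \<Longrightarrow>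
    word_product (ws @ vs) = word_product ws \<otimes> word_product vs"
  by (induction ws) (auto simp: m_assoc word_product_closed)

lemma free_product_words_append:
  "ws @ vs \<in> free_product_words G A B \<longleftrightarrow> ws \<in> free_product_words G A B \<and>
    vs \<in> free_product_words G A B \<and> (ws \<noteq> [] \<longrightarrow> vs \<noteq> [] \<longrightarrow> fst (last ws) \<noteq> fst (hd vs))"
  unfolding free_product_words_def by (auto simp: successively_append_iff)

lemma free_product_words_single:
  "[(c, g)] \<in> free_product_words G A B \<longleftrightarrow> g \<noteq> \<one>\<^bsub>G\<^esub> \<and> g \<in> (if c then A else B)"
  unfolding free_product_words_def by auto

locale free_product = group G for G (structure) +
  fixes A B
  assumes free_product: "is_free_product G A B"
begin

lemma subgroups: "subgroup A G" "subgroup B G"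
  using free_product by (auto simp: is_free_product_def)

lemma factor_mem_carrier: "s \<in> (if c then A else B) \<Longrightarrow> s \<in> carrier G"
  using subgroups by (cases c) (auto dest: subgroup.mem_carrier)

lemma factor_mult: "s \<in> (if c then A else B) \<Longrightarrow> t \<in> (if c then A else B) \<Longrightarrow>
    s \<otimes> t \<in> (if c then A else B)"
  using subgroups by (cases c) (auto dest: subgroup.m_closed)

lemma words_carrier: "ws \<in> free_product_words G A B \<Longrightarrow> snd ` set ws \<subseteq> carrier G"
  using subgroups unfolding free_product_words_def
  by (fastforce dest: subgroup.subset split: if_splits)

lemma normal_form_unique:
  "ws \<in> free_product_words G A B \<Longrightarrow> vs \<in> free_product_words G A B \<Longrightarrow>
    word_product ws = word_product vs \<Longrightarrow> ws = vs"
  using free_product unfolding is_free_product_def bij_betw_def by (meson inj_onD)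

lemma normal_form_exists:
  assumes "y \<in> carrier G"
  obtains ws where "ws \<in> free_product_words G A B" "word_product ws = y"
proof -
  have "y \<in> word_product ` free_product_words G A B"
    using free_product assms unfolding is_free_product_def bij_betw_def by simp
  then show ?thesis using that by blast
qed

definition starts_left :: "'a \<Rightarrow> bool" where
  "starts_left y \<longleftrightarrow> (\<exists>ws\<in>free_product_words G A B. ws \<noteq> [] \<and> fst (hd ws) \<and> word_product ws = y)"

lemma starts_left_word:
  assumes "ws \<in> free_product_words G A B"
  shows "starts_left (word_product ws) \<longleftrightarrow> ws \<noteq> [] \<and> fst (hd ws)"
  using assms normal_form_unique unfolding starts_left_def by blast

text \<open>A factor on the right touches only the last syllable: it is appended, merged or
  cancelled. A merged syllable stays in its factor, so even a single syllable keeps its side; only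
  passing to or from the identity can change it.\<close>

lemma starts_left_mult_factor:
  assumes y: "y \<in> carrier G" "y \<noteq> \<one>" and s: "s \<in> (if c then A else B)" and ys: "y \<otimes> s \<noteq> \<one>"
  shows "starts_left (y \<otimes> s) \<longleftrightarrow> starts_left y"
proof (cases "s = \<one>")
  case False
  have sG: "s \<in> carrier G" using factor_mem_carrier[OF s] .
  obtain ws where ws: "ws \<in> free_product_words G A B" "word_product ws = y"
    using normal_form_exists[OF y(1)] .
  have "ws \<noteq> []" using ws y by auto
  then obtain vs d t where vs: "ws = vs @ [(d, t)]" by (metis rev_exhaust surj_pair)
  have t: "t \<noteq> \<one>" "t \<in> (if d then A else B)" and vsw: "vs \<in> free_product_words G A B"
    and alt: "vs \<noteq> [] \<Longrightarrow> fst (last vs) \<noteq> d"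
    using ws(1) unfolding vs free_product_words_append free_product_words_single by auto
  have tG: "t \<in> carrier G" using factor_mem_carrier[OF t(2)] .
  have vsG: "snd ` set vs \<subseteq> carrier G" using words_carrier[OF vsw] .
  have yv: "y = word_product vs \<otimes> t"
    using ws(2) word_product_append[OF vsG, of "[(d, t)]"] tG unfolding vs by simp
  then have ysv: "y \<otimes> s = word_product vs \<otimes> (t \<otimes> s)"
    using word_product_closed[OF vsG] tG sG by (simp add: m_assoc)
  have start: "starts_left y \<longleftrightarrow> fst (hd ws)"
    using starts_left_word[OF ws(1)] ws(2) \<open>ws \<noteq> []\<close> by simp
  show ?thesis
  proof (cases "d = c")
    case neq: False
    have w: "ws @ [(c, s)] \<in> free_product_words G A B"
      using ws(1) s neq \<open>s \<noteq> \<one>\<close> unfolding free_product_words_append free_product_words_single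
      by (simp add: vs)
    have "word_product (ws @ [(c, s)]) = y \<otimes> s"
      using word_product_append[OF words_carrier[OF ws(1)], of "[(c, s)]"] sG ws(2) by simp
    then show ?thesis using starts_left_word[OF w] start \<open>ws \<noteq> []\<close> by simp
  next
    case eq: True
    have ts: "t \<otimes> s \<in> (if c then A else B)"
      using t(2) s unfolding eq by (rule factor_mult)
    show ?thesis
    proof (cases "t \<otimes> s = \<one>")
      case True
      then have "y \<otimes> s = word_product vs" using ysv word_product_closed[OF vsG] by simp
      moreover from this have "vs \<noteq> []" using ys by auto
      ultimately show ?thesis using starts_left_word[OF vsw] start vs by simp
    next
      case False
      then have w: "vs @ [(c, t \<otimes> s)] \<in> free_product_words G A B"
        using vsw ts alt eq unfolding free_product_words_append free_product_words_single by simp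
      have "word_product (vs @ [(c, t \<otimes> s)]) = y \<otimes> s"
        using word_product_append[OF vsG, of "[(c, t \<otimes> s)]"] ysv tG sG by simp
      then show ?thesis using starts_left_word[OF w] start vs eq by (cases vs) auto
    qed
  qed
qed (use y in simp)

text \<open>Multiply by the syllables of \<open>z\<close> one at a time. Each has at most the two
  exceptional points \<open>\<one>\<close> and \<open>inv s\<close>, and the exceptions of the
  remaining syllables are merely translated.\<close>

lemma finite_starts_left_coboundary:
  assumes "z \<in> carrier G"
  shows "finite {y \<in> carrier G. starts_left (y \<otimes> z) \<noteq> starts_left y}"
proof -
  obtain ws where ws: "ws \<in> free_product_words G A B" "word_product ws = z"
    using normal_form_exists[OF assms] .
  have "finite {y \<in> carrier G. starts_left (y \<otimes> word_product ws) \<noteq> starts_left y}"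
    using ws(1)
  proof (induction ws)
    case Nil
    have "{y \<in> carrier G. starts_left (y \<otimes> word_product []) \<noteq> starts_left y} = {}" by auto
    then show ?case by (simp only: finite.emptyI)
  next
    case (Cons cs ws)
    obtain c s where cs: "cs = (c, s)" by (cases cs)
    have "[(c, s)] @ ws \<in> free_product_words G A B" using Cons.prems cs by simp
    then have s: "s \<in> (if c then A else B)" and w: "ws \<in> free_product_words G A B"
      unfolding free_product_words_append free_product_words_single by auto
    have sG: "s \<in> carrier G" using factor_mem_carrier[OF s] .
    let ?z = "word_product ws"
    have zG: "?z \<in> carrier G" using words_carrier[OF w] word_product_closed by blast
    let ?T = "{y \<in> carrier G. starts_left (y \<otimes> ?z) \<noteq> starts_left y}"
    have "{y \<in> carrier G. starts_left (y \<otimes> word_product (cs # ws)) \<noteq> starts_left y}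
      \<subseteq> {\<one>, inv s} \<union> (\<lambda>y. y \<otimes> inv s) ` ?T"
    proof
      fix y assume y: "y \<in> {y \<in> carrier G. starts_left (y \<otimes> word_product (cs # ws))
          \<noteq> starts_left y}"
      then have yG: "y \<in> carrier G" and ne: "starts_left (y \<otimes> s \<otimes> ?z) \<noteq> starts_left y"
        using sG zG by (auto simp: cs m_assoc)
      show "y \<in> {\<one>, inv s} \<union> (\<lambda>y. y \<otimes> inv s) ` ?T"
      proof (cases "y = \<one> \<or> y = inv s")
        case False
        have "y \<otimes> s \<noteq> \<one>" using False inv_equality[OF _ sG yG] by auto
        then have "starts_left (y \<otimes> s) = starts_left y"
          using starts_left_mult_factor[OF yG _ s] False by blast
        then have "y \<otimes> s \<in> ?T" using ne yG sG by simp
        moreover have "y = y \<otimes> s \<otimes> inv s" using yG sG by (simp add: m_assoc)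
        ultimately show ?thesis by blast
      qed blast
    qed
    moreover have "finite ({\<one>, inv s} \<union> (\<lambda>y. y \<otimes> inv s) ` ?T)" using Cons.IH[OF w] by simp
    ultimately show ?case by (rule finite_subset)
  qed
  then show ?thesis using ws by simp
qed

lemma starts_left_mult_left:
  assumes "y \<in> carrier G" "y \<notin> A" "a \<in> A"
  shows "starts_left (y \<otimes> a) \<longleftrightarrow> starts_left y"
proof -
  interpret A: subgroup A G by (rule subgroups)
  have "y \<noteq> \<one>" using assms A.one_closed by auto
  moreover have "y \<otimes> a \<noteq> \<one>"
    using assms inv_equality[of y a] A.m_inv_closed[of a] A.mem_carrier[of a] by auto
  ultimately show ?thesis using starts_left_mult_factor[of y a True] assms by simp
qed

lemma starts_left_left:
  assumes "a \<in> A" "a \<noteq> \<one>"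
  shows "starts_left a"
  using starts_left_word[of "[(True, a)]"] assms subgroup.mem_carrier[OF subgroups(1)]
  by (simp add: free_product_words_single)

text \<open>The normal forms \<open>a b a b ...\<close> or \<open>b a b a ...\<close> of growing
  length are distinct elements on the prescribed side.\<close>

lemma infinite_starts_left:
  assumes "a \<in> A" "a \<noteq> \<one>" "b \<in> B" "b \<noteq> \<one>"
  shows "infinite {y \<in> carrier G. starts_left y \<longleftrightarrow> c}"
proof -
  define pair where "pair = (if c then [(True, a), (False, b)] else [(False, b), (True, a)])"
  define W where "W k = concat (replicate (Suc k) pair)" for k
  have W: "W k \<in> free_product_words G A B \<and> W k \<noteq> [] \<and> fst (hd (W k)) = c \<and> length (W k)
      = 2 * Suc k" for k
  proof (induction k)
    case 0
    show ?case using assms by (auto simp: W_def pair_def free_product_words_def)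
  next
    case (Suc k)
    have p: "pair \<in> free_product_words G A B" "pair \<noteq> []" "fst (hd pair) = c" "fst (last pair) \<noteq> c"
      "length pair = 2"
      using assms by (auto simp: pair_def free_product_words_def)
    have "W (Suc k) = pair @ W k" by (simp add: W_def)
    then show ?case using Suc p by (auto simp: free_product_words_append)
  qed
  have inj: "inj (\<lambda>k. word_product (W k))"
  proof (rule injI)
    fix k l assume "word_product (W k) = word_product (W l)"
    then have "W k = W l" using W normal_form_unique by blast
    then have "length (W k) = length (W l)" by simp
    then show "k = l" using W by simp
  qed
  have "word_product (W k) \<in> {y \<in> carrier G. starts_left y \<longleftrightarrow> c}" for k
    using W[of k] starts_left_word[of "W k"] word_product_closed[OF words_carrier[of "W k"]] by auto
  then have "range (\<lambda>k. word_product (W k)) \<subseteq> {y \<in> carrier G. starts_left y \<longleftrightarrow> c}" by auto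
  then show ?thesis using range_inj_infinite[OF inj] by (rule infinite_super)
qed

end


section \<open>Separable words omit a pair of positive letters\<close>

lemma reduced_single [simp]: "reduced [a]"
  by (simp add: reduced_def)

lemma reduced_replicate: "reduced (replicate k a)"
proof (induction k)
  case (Suc k)
  then show ?case by (cases k) (auto simp: reduced_Cons)
qed simp

lemma carrier_append:
  "v @ w \<in> carrier (free_group X) \<Longrightarrow> v \<in> carrier (free_group X) \<and> w \<in> carrier (free_group X)"
  by (auto simp: carrier_free_group reduced_append)

lemma word_pow_carrier:
  assumes "cyclically_reduced w" "w \<in> carrier (free_group X)"
  shows "word_pow w k \<in> carrier (free_group X)"
proof -
  have "set (word_pow w k) \<subseteq> set w" by auto
  then have "fst ` set (word_pow w k) \<subseteq> fst ` set w" by (rule image_mono)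
  then show ?thesis using reduced_word_pow[OF assms(1)] assms(2) by (auto simp: carrier_free_group)
qed

text \<open>By downward induction on the level of a vertex \<open>q\<close> of the Cayley tree, \<open>f\<close> is constant far out
  in the cone of \<open>q\<close>: an occurrence of the pair \<open>x y\<close> in \<open>w\<close> gives a line that joins the branches
  at \<open>q\<close> of \<open>x\<^sup>-\<^sup>1\<close> and \<open>y\<close>. With two generators both kinds of branches exist below every \<open>q\<close>.\<close>

lemma constant_at_infinity:
  fixes f :: "'a letter list \<Rightarrow> bool"
  assumes X: "x1 \<in> X" "x2 \<in> X" "x1 \<noteq> x2"
    and w: "cyclically_reduced w" "w \<in> carrier (free_group X)"
    and pairs: "\<And>x y. x \<in> X \<Longrightarrow> y \<in> X \<Longrightarrow> \<exists>a b. w = a @ [(x, True), (y, True)] @ b"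
    and far: "\<And>g z. g @ [z] \<in> carrier (free_group X) \<Longrightarrow> R \<le> length g \<Longrightarrow> f (g @ [z]) = f g"
    and lines: "\<And>q a b. q \<in> carrier (free_group X) \<Longrightarrow> w = a @ b \<Longrightarrow>
      \<exists>K. \<forall>k\<ge>K. f (q \<otimes>\<^bsub>free_group X\<^esub> (b @ word_pow w k))
        = f (q \<otimes>\<^bsub>free_group X\<^esub> word_inv (word_pow w k @ a))"
    and g: "g \<in> carrier (free_group X)" "R \<le> length g"
    and g': "g' \<in> carrier (free_group X)" "R \<le> length g'"
  shows "f g = f g'"
proof -
  let ?F = "carrier (free_group X)"
  note pow_carrier = word_pow_carrier[OF w]
  have "w \<noteq> []" using pairs[OF X(1,1)] by auto
  have pow_length: "k \<le> length (word_pow w k)" for k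
    using \<open>w \<noteq> []\<close> by (simp add: length_word_pow Suc_le_eq)
  have "f (q @ t) = f (q @ t')" if "r \<le> R" "length q = r" "q @ t \<in> ?F" "q @ t' \<in> ?F"
    "R \<le> length (q @ t)" "R \<le> length (q @ t')" for r q t t'
    using that
  proof (induction r arbitrary: q t t' rule: inc_induct)
    \<comment> \<open>\<open>q\<close> already has length \<open>R\<close>, so by \<open>far\<close>
      no further letter changes \<open>f\<close>.\<close>
    case base
    have "f (q @ t) = f q" if "q @ t \<in> ?F" for t
      using that
    proof (induction t rule: rev_induct)
      case (snoc z t)
      then show ?case
        using far[of "q @ t" z] carrier_append[of "q @ t" "[z]" X] base by simp
    qed simp
    then show ?case using base by metis
  next
    case (step r)
    have opposite: "f (q @ (i, False) # t) = f (q @ (j, True) # t')"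
      if t: "q @ (i, False) # t \<in> ?F" "R \<le> length (q @ (i, False) # t)"
        and t': "q @ (j, True) # t' \<in> ?F" "R \<le> length (q @ (j, True) # t')" for i j t t'
    proof -
      have q: "q \<in> ?F" using carrier_append[OF t(1)] by blast
      have "i \<in> X" "j \<in> X" using t t' by (auto simp: carrier_free_group)
      then obtain a b where ab: "w = a @ [(i, True), (j, True)] @ b" using pairs by blast
      \<comment> \<open>Cut \<open>w\<close> between the two letters: the forward half-line from
        \<open>q\<close> then begins with \<open>j\<close>, and the backward one with the inverse of
        \<open>i\<close>.\<close>
      let ?a = "a @ [(i, True)]" let ?b = "(j, True) # b"
      have "w = ?a @ ?b" using ab by simp
      then obtain K where K: "\<forall>k\<ge>K. f (q \<otimes>\<^bsub>free_group X\<^esub> (?b @ word_pow w k))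
        = f (q \<otimes>\<^bsub>free_group X\<^esub> word_inv (word_pow w k @ ?a))"
        using lines[OF q, of ?a ?b] by blast
      \<comment> \<open>\<open>K\<close> makes the two ends of the line agree, and \<open>R\<close>
        pushes both of them beyond length \<open>R\<close>.\<close>
      define k where "k = max K R"
      define s where "s = b @ word_pow w k"
      define s' where "s' = word_inv (word_pow w k @ a)"
      have "word_pow w (Suc k) = ?a @ (?b @ word_pow w k)" by (simp add: ab)
      then have bw: "[(j, True)] @ s \<in> ?F"
        using pow_carrier[of "Suc k"] carrier_append[of ?a "?b @ word_pow w k" X]
          by (simp add: s_def)
      have "word_pow w (Suc k) = (word_pow w k @ ?a) @ ?b"
        using word_pow_Suc'[where w = w and k = k] ab by simp
      then have "word_pow w k @ ?a \<in> ?F"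
        using pow_carrier[of "Suc k"] carrier_append[of "word_pow w k @ ?a" ?b X] by simp
      then have "word_inv (word_pow w k @ ?a) \<in> ?F"
        unfolding carrier_free_group by (simp only: reduced_word_inv word_inv_simps(6) simp_thms)
      then have aw: "[(i, False)] @ s' \<in> ?F" by (simp add: s'_def inv_letter_def)
      have qs: "reduced (q @ [(j, True)] @ s)"
        using t'(1) bw by (intro reduced_overlap) (auto simp: carrier_free_group reduced_append)
      have qs': "reduced (q @ [(i, False)] @ s')"
        using t(1) aw by (intro reduced_overlap) (auto simp: carrier_free_group reduced_append)
      have long: "R \<le> length s" "R \<le> length s'"
        using pow_length[of k] by (auto simp: s_def s'_def k_def)
      \<comment> \<open>The induction hypothesis leads, inside the branch of \<open>j\<close>, from
        the given point to the end of the line; the other end is treated alike in the branch of the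
        inverse of \<open>i\<close>.\<close>
      have "f (q @ (j, True) # t') = f ((q @ [(j, True)]) @ s)"
        using step.IH[of "q @ [(j, True)]" t' s] t' qs bw q long step.prems(1)
        by (auto simp: carrier_free_group)
      also have "\<dots> = f (q \<otimes>\<^bsub>free_group X\<^esub> (?b @ word_pow w k))"
        using mult_free_group_reduced[OF qs] by (simp add: s_def)
      also have "\<dots> = f (q \<otimes>\<^bsub>free_group X\<^esub> word_inv (word_pow w k @ ?a))"
        using K by (simp add: k_def)
      also have "\<dots> = f ((q @ [(i, False)]) @ s')"
        using mult_free_group_reduced[OF qs'] by (simp add: s'_def inv_letter_def)
      also have "\<dots> = f (q @ (i, False) # t)"
        using step.IH[of "q @ [(i, False)]" t s'] t qs' aw q long step.prems(1)
        by (auto simp: carrier_free_group)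
      finally show ?thesis by simp
    qed
    have q: "q \<in> ?F" using carrier_append[OF step.prems(2)] by blast
    \<comment> \<open>For a given sign, the last letter of \<open>q\<close> blocks at most one of
      the two generators; repeating the other one leads beyond \<open>R\<close>.\<close>
    have ext: "\<exists>i. q @ (i, e) # replicate R (i, e) \<in> ?F" for e
    proof -
      obtain i where i: "i \<in> X" "q \<noteq> [] \<longrightarrow> last q \<noteq> (i, \<not> e)" using X
        by (cases "last q = (x1, \<not> e)") auto
      have "(i, e) \<noteq> inv_letter (last q)" if "q \<noteq> []"
        using i(2) that by (metis fst_conv inv_letter_def inv_letter_inv_letter snd_conv)
      then have "reduced (q @ replicate (Suc R) (i, e))"
        using q reduced_replicate[of "Suc R" "(i, e)"] unfolding reduced_append
        by (auto simp: carrier_free_group)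
      then show ?thesis using q i by (intro exI[of _ i]) (auto simp: carrier_free_group)
    qed
    obtain i where i: "q @ (i, False) # replicate R (i, False) \<in> ?F" using ext by blast
    obtain j where j: "q @ (j, True) # replicate R (j, True) \<in> ?F" using ext by blast
    \<comment> \<open>Every branch is compared with the negative branch of \<open>i\<close>:
      positive ones directly, negative ones by way of the positive branch of
      \<open>j\<close>.\<close>
    have all: "f (q @ t) = f (q @ (i, False) # replicate R (i, False))"
      if t: "q @ t \<in> ?F" "R \<le> length (q @ t)" for t
    proof -
      have "t \<noteq> []" using t step by auto
      then obtain x e s where x: "t = (x, e) # s" by (metis neq_Nil_conv surj_pair)
      show ?thesis
      proof (cases e)
        case True
        then show ?thesis using opposite[OF i, of x s] t x by simp
      next
        case False
        then show ?thesis using opposite[of x s j "replicate R (j, True)"]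
            opposite[OF i, of j "replicate R (j, True)"] t x j by simp
      qed
    qed
    show ?case using all step.prems by metis
  qed
  from this[of 0 "[]" g g'] show ?thesis using g g' by simp
qed

section \<open>Powers of conjugates and the cut vertex lemma\<close>

lemma (in group) conj_pow:
  assumes "h \<in> carrier G" "w \<in> carrier G"
  shows "(h \<otimes> w \<otimes> inv h) [^] (k::nat) = h \<otimes> w [^] k \<otimes> inv h"
proof (induction k)
  case 0
  then show ?case using assms by simp
next
  case (Suc k)
  have "h \<otimes> w [^] k \<otimes> inv h \<otimes> (h \<otimes> w \<otimes> inv h) = h \<otimes> w [^] k \<otimes> (inv h \<otimes> h) \<otimes> w \<otimes> inv h"
    using assms by (simp only: m_assoc m_closed inv_closed nat_pow_closed)
  then show ?case using Suc assms by (simp add: m_assoc)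
qed

lemma word_pow_nat_pow:
  assumes "cyclically_reduced w" "w \<in> carrier (free_group X)"
  shows "w [^]\<^bsub>free_group X\<^esub> k = word_pow w k"
proof (induction k)
  case (Suc k)
  interpret group "free_group X" by (rule group_free_group)
  have "reduced (word_pow w k @ w)"
    using reduced_word_pow[OF assms(1), of "Suc k"] unfolding word_pow_Suc' .
  then show ?case using Suc by (simp only: nat_pow_Suc mult_free_group_reduced word_pow_Suc')
qed (simp add: one_free_group)

lemma finite_short_words:
  assumes "finite X"
  shows "finite {w \<in> carrier (free_group X). length w < R}"
proof (rule finite_subset)
  show "{w \<in> carrier (free_group X). length w < R} \<subseteq> {w. set w \<subseteq> X \<times> UNIV \<and> length w \<le> R}"
    by (auto simp: carrier_free_group)
  show "finite {w. set w \<subseteq> X \<times> (UNIV :: bool set) \<and> length w \<le> R}"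
    using assms by (intro finite_lists_length_le) simp
qed

text \<open>Geometrically, \<open>\<alpha>\<close> fixes a vertex of the Bass--Serre tree, so that the two ends of its lines
  are not separated by any edge.\<close>

lemma (in free_product) starts_left_line:
  assumes y: "y \<in> carrier G" and \<alpha>: "\<alpha> \<in> A"
    and order: "\<And>z. z \<in> carrier G \<Longrightarrow> \<exists>K. \<forall>k\<ge>K. \<alpha> [^] (k::nat) \<noteq> z"
  shows "\<exists>K. \<forall>k\<ge>K. starts_left (y \<otimes> \<alpha> [^] Suc k) \<longleftrightarrow> starts_left (y \<otimes> inv (\<alpha> [^] k))"
proof -
  interpret A: subgroup A G by (rule subgroups)
  have \<alpha>G: "\<alpha> \<in> carrier G" using \<alpha> by simp
  have pow: "\<alpha> [^] k \<in> A" for k :: nat by (induction k) (use \<alpha> in auto)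
  show ?thesis
  proof (cases "y \<in> A")
    \<comment> \<open>Outside \<open>A\<close>, right multiplication by powers of \<alpha> never
      leaves the side of \<open>y\<close>.\<close>
    case False
    then show ?thesis using starts_left_mult_left[OF y False] pow A.m_inv_closed by blast
  next
    case True
    \<comment> \<open>In \<open>A\<close> only the identity does not start left, so the ends agree
      once the powers of \<alpha> have passed \<open>inv y\<close> and \<open>y\<close>.\<close>
    obtain K :: nat where K: "\<forall>k\<ge>K. \<alpha> [^] k \<noteq> inv y" using order[OF inv_closed[OF y]] by blast
    obtain L :: nat where L: "\<forall>k\<ge>L. \<alpha> [^] k \<noteq> y" using order[OF y] by blast
    have "starts_left (y \<otimes> \<alpha> [^] Suc k)" if "k \<ge> K" for k
    proof (rule starts_left_left)
      show "y \<otimes> \<alpha> [^] Suc k \<in> A" using True pow by (intro A.m_closed)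
      show "y \<otimes> \<alpha> [^] Suc k \<noteq> \<one>"
      proof
        assume "y \<otimes> \<alpha> [^] Suc k = \<one>"
        then have "inv y = \<alpha> [^] Suc k"
          using y \<alpha>G by (metis inv_comm inv_equality nat_pow_closed)
        then show False using K that by (metis le_SucI)
      qed
    qed
    moreover have "starts_left (y \<otimes> inv (\<alpha> [^] k))" if "k \<ge> L" for k
    proof (rule starts_left_left)
      show "y \<otimes> inv (\<alpha> [^] k) \<in> A" using True pow by (intro A.m_closed A.m_inv_closed)
      show "y \<otimes> inv (\<alpha> [^] k) \<noteq> \<one>"
      proof
        assume "y \<otimes> inv (\<alpha> [^] k) = \<one>"
        then have "inv (inv (\<alpha> [^] k)) = y"
          using y \<alpha>G by (intro inv_equality) auto
        then show False using L that \<alpha>G by simp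
      qed
    qed
    ultimately show ?thesis by (intro exI[of _ "max K L"]) simp
  qed
qed

text \<open>If the \<open>k\<close>-th power is \<open>z\<close>, then the \<open>k\<close>-th power
  of \<open>w\<close> is a fixed conjugate of \<open>z\<close>. Its length is at least
  \<open>k\<close>, because the powers of a cyclically reduced word do not cancel; so
  \<open>k\<close> is bounded.\<close>

lemma word_pow_conj_avoids:
  assumes w: "cyclically_reduced w" "w \<in> carrier (free_group X)" "w \<noteq> []"
    and h: "h \<in> carrier (free_group X)" and z: "z \<in> carrier (free_group X)"
  shows "\<exists>K. \<forall>k\<ge>K. (h \<otimes>\<^bsub>free_group X\<^esub> w \<otimes>\<^bsub>free_group X\<^esub> inv\<^bsub>free_group X\<^esub> h) [^]\<^bsub>free_group X\<^esub>
      (k::nat) \<noteq> z"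
proof -
  interpret group "free_group X" by (rule group_free_group)
  let ?F = "free_group X"
  let ?u = "inv\<^bsub>?F\<^esub> h \<otimes>\<^bsub>?F\<^esub> z \<otimes>\<^bsub>?F\<^esub> h"
  have "k \<le> length ?u" if "(h \<otimes>\<^bsub>?F\<^esub> w \<otimes>\<^bsub>?F\<^esub> inv\<^bsub>?F\<^esub> h) [^]\<^bsub>?F\<^esub> k = z" for k :: nat
  proof -
    have wk: "w [^]\<^bsub>?F\<^esub> k \<in> carrier ?F" using w(2) by (rule nat_pow_closed)
    have "?u = inv\<^bsub>?F\<^esub> h \<otimes>\<^bsub>?F\<^esub> (h \<otimes>\<^bsub>?F\<^esub> w [^]\<^bsub>?F\<^esub> k \<otimes>\<^bsub>?F\<^esub> inv\<^bsub>?F\<^esub> h) \<otimes>\<^bsub>?F\<^esub> h"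
      using that conj_pow[OF h w(2)] by simp
    also have "\<dots> = (inv\<^bsub>?F\<^esub> h \<otimes>\<^bsub>?F\<^esub> h) \<otimes>\<^bsub>?F\<^esub> w [^]\<^bsub>?F\<^esub> k \<otimes>\<^bsub>?F\<^esub> (inv\<^bsub>?F\<^esub> h \<otimes>\<^bsub>?F\<^esub> h)"
      using h wk by (simp only: m_assoc m_closed inv_closed)
    also have "\<dots> = word_pow w k"
      using h wk word_pow_nat_pow[OF w(1,2)] by simp
    finally show ?thesis using w(3) by (simp add: length_word_pow Suc_le_eq)
  qed
  then show ?thesis by (intro exI[of _ "Suc (length ?u)"]) (metis not_less_eq_eq)
qed

text \<open>An element of a free factor need not be cyclically reduced, whereas the pairs have to be
  read in a cyclically reduced word. The conjugator \<open>h\<close> bridges the two.\<close>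

lemma separable_word_avoids_pair:
  fixes X :: "'a set"
  assumes X: "finite X" "x1 \<in> X" "x2 \<in> X" "x1 \<noteq> x2"
    and w: "cyclically_reduced w" "w \<in> carrier (free_group X)"
    and h: "h \<in> carrier (free_group X)"
    and sep: "separable (free_group X) (h \<otimes>\<^bsub>free_group X\<^esub> w \<otimes>\<^bsub>free_group X\<^esub> inv\<^bsub>free_group X\<^esub> h)"
  shows "\<exists>x\<in>X. \<exists>y\<in>X. \<nexists>a b. w = a @ [(x, True), (y, True)] @ b"
proof (rule ccontr)
  assume "\<not> ?thesis"
  then have pairs: "\<And>x y. x \<in> X \<Longrightarrow> y \<in> X \<Longrightarrow> \<exists>a b. w = a @ [(x, True), (y, True)] @ b" by blast
  then have w0: "w \<noteq> []" using X by fastforce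
  define F where "F = free_group X"
  interpret group F unfolding F_def by (rule group_free_group)
  note w = w[folded F_def] and h = h[folded F_def]
  define \<alpha> where "\<alpha> = h \<otimes>\<^bsub>F\<^esub> w \<otimes>\<^bsub>F\<^esub> inv\<^bsub>F\<^esub> h"
  obtain A B where A: "\<alpha> \<in> A" "nontrivial_proper_subgroup F A" "nontrivial_proper_subgroup F B"
    "is_free_product F A B"
    using sep unfolding separable_def proper_free_factor_def \<alpha>_def F_def by blast
  interpret free_product F A B by unfold_locales (rule A)
  obtain a b where ab: "a \<in> A" "a \<noteq> \<one>\<^bsub>F\<^esub>" "b \<in> B" "b \<noteq> \<one>\<^bsub>F\<^esub>"
    using A(2,3) subgroup.one_closed unfolding nontrivial_proper_subgroup_def by blast
  \<comment> \<open>The shift by \<open>h\<close> turns lines along the powers of \<alpha> into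
    lines along the powers of \<open>w\<close>, which can be read as words.\<close>
  define f where "f g = starts_left (g \<otimes>\<^bsub>F\<^esub> inv\<^bsub>F\<^esub> h)" for g
  \<comment> \<open>A change of \<open>f\<close> from \<open>g\<close> to \<open>g z\<close> is a
    change of \<open>starts_left\<close> when \<open>g h^-1\<close> is multiplied by
    \<open>h z h^-1\<close>.\<close>
  have coboundary: "finite {g \<in> carrier F. f (g \<otimes>\<^bsub>F\<^esub> z) \<noteq> f g}" if z: "z \<in> carrier F" for z
  proof (rule finite_subset)
    let ?z = "h \<otimes>\<^bsub>F\<^esub> z \<otimes>\<^bsub>F\<^esub> inv\<^bsub>F\<^esub> h"
    let ?T = "{y \<in> carrier F. starts_left (y \<otimes>\<^bsub>F\<^esub> ?z) \<noteq> starts_left y}"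
    show "finite ((\<lambda>y. y \<otimes>\<^bsub>F\<^esub> h) ` ?T)"
      using finite_starts_left_coboundary[of ?z] h z by simp
    show "{g \<in> carrier F. f (g \<otimes>\<^bsub>F\<^esub> z) \<noteq> f g} \<subseteq> (\<lambda>y. y \<otimes>\<^bsub>F\<^esub> h) ` ?T"
    proof
      fix g assume g: "g \<in> {g \<in> carrier F. f (g \<otimes>\<^bsub>F\<^esub> z) \<noteq> f g}"
      let ?y = "g \<otimes>\<^bsub>F\<^esub> inv\<^bsub>F\<^esub> h"
      have "?y \<otimes>\<^bsub>F\<^esub> ?z = g \<otimes>\<^bsub>F\<^esub> (inv\<^bsub>F\<^esub> h \<otimes>\<^bsub>F\<^esub> h) \<otimes>\<^bsub>F\<^esub> z \<otimes>\<^bsub>F\<^esub> inv\<^bsub>F\<^esub> h"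
        using g h z by (simp only: m_assoc m_closed inv_closed mem_Collect_eq)
      also have "\<dots> = g \<otimes>\<^bsub>F\<^esub> z \<otimes>\<^bsub>F\<^esub> inv\<^bsub>F\<^esub> h" using g h z by simp
      finally have "?y \<in> ?T" using g h unfolding f_def by simp
      moreover have "g = ?y \<otimes>\<^bsub>F\<^esub> h" using g h by (simp add: m_assoc)
      ultimately show "g \<in> (\<lambda>y. y \<otimes>\<^bsub>F\<^esub> h) ` ?T" by blast
    qed
  qed
  \<comment> \<open>The start points of the finitely many edges of the Cayley tree across which
    \<open>f\<close> changes; \<open>R\<close> will exceed their lengths.\<close>
  define U where "U = (\<Union>z\<in>X \<times> UNIV. {g \<in> carrier F. f (g \<otimes>\<^bsub>F\<^esub> [z]) \<noteq> f g})"
  have "finite U"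
    unfolding U_def using X(1) by (intro finite_UN_I coboundary) (auto simp: F_def
      carrier_free_group)
  then have "finite (length ` U)" by simp
  then obtain R where R: "\<forall>l\<in>length ` U. l < R" using finite_nat_set_iff_bounded by blast
  have far: "f (g @ [z]) = f g" if g: "g @ [z] \<in> carrier F" "R \<le> length g" for g z
  proof -
    have gF: "g \<in> carrier F" and "fst z \<in> X" and mult: "g \<otimes>\<^bsub>F\<^esub> [z] = g @ [z]"
      using g carrier_append[of g "[z]" X] mult_free_group_reduced[of g "[z]" X]
      by (auto simp: F_def carrier_free_group)
    then have "z \<in> X \<times> UNIV" by (simp add: mem_Times_iff)
    then have "{g \<in> carrier F. f (g \<otimes>\<^bsub>F\<^esub> [z]) \<noteq> f g} \<subseteq> U"
      unfolding U_def by (rule UN_upper)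
    moreover have "g \<notin> U" using R g(2) by force
    ultimately show ?thesis using gF unfolding mult[symmetric] by blast
  qed
  have lines: "\<exists>K. \<forall>k\<ge>K. f (q \<otimes>\<^bsub>F\<^esub> (b @ word_pow w k)) = f (q \<otimes>\<^bsub>F\<^esub> word_inv (word_pow w k @ a))"
    if q: "q \<in> carrier F" and ab: "w = a @ b" for q a b
  proof -
    have abF: "a \<in> carrier F" "b \<in> carrier F" using w(2) carrier_append unfolding ab F_def by blast+
    \<comment> \<open>With this \<open>y\<close>, the points \<open>y \<alpha>^(k+1) h\<close> and
      \<open>y \<alpha>^(-k) h\<close> are \<open>q b w^k\<close> and \<open>q (w^k a)^-1\<close>,
      on the two half-lines that leave \<open>q\<close> when \<open>w\<close> is cut into
      \<open>a\<close> and \<open>b\<close>.\<close>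
    define y where "y = q \<otimes>\<^bsub>F\<^esub> inv\<^bsub>F\<^esub> a \<otimes>\<^bsub>F\<^esub> inv\<^bsub>F\<^esub> h"
    have y: "y \<in> carrier F" using q abF h by (simp add: y_def)
    obtain K where K: "\<forall>k\<ge>K. starts_left (y \<otimes>\<^bsub>F\<^esub> \<alpha> [^]\<^bsub>F\<^esub> Suc k)
        = starts_left (y \<otimes>\<^bsub>F\<^esub> inv\<^bsub>F\<^esub> (\<alpha> [^]\<^bsub>F\<^esub> k))"
      using starts_left_line[OF y A(1)] word_pow_conj_avoids[OF w(1) w(2)[unfolded F_def] w0
        h[unfolded F_def]]
      unfolding \<alpha>_def F_def by blast
    have "y \<otimes>\<^bsub>F\<^esub> \<alpha> [^]\<^bsub>F\<^esub> Suc k = q \<otimes>\<^bsub>F\<^esub> (b @ word_pow w k) \<otimes>\<^bsub>F\<^esub> inv\<^bsub>F\<^esub> h"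
      and "y \<otimes>\<^bsub>F\<^esub> inv\<^bsub>F\<^esub> (\<alpha> [^]\<^bsub>F\<^esub> k) = q \<otimes>\<^bsub>F\<^esub> word_inv (word_pow w k @ a) \<otimes>\<^bsub>F\<^esub> inv\<^bsub>F\<^esub> h" for k
    proof -
      have wkF: "word_pow w l \<in> carrier F" for l
        using word_pow_carrier[OF w(1)] w(2) unfolding F_def by blast
      have pow: "\<alpha> [^]\<^bsub>F\<^esub> l = h \<otimes>\<^bsub>F\<^esub> word_pow w l \<otimes>\<^bsub>F\<^esub> inv\<^bsub>F\<^esub> h" for l
        using conj_pow[OF h w(2)] word_pow_nat_pow[OF w(1)] w(2) unfolding \<alpha>_def F_def by simp
      have "word_pow w (Suc k) = a @ (b @ word_pow w k)" by (simp add: ab)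
      then have bk: "b @ word_pow w k \<in> carrier F"
        and red: "word_pow w (Suc k) = a \<otimes>\<^bsub>F\<^esub> (b @ word_pow w k)"
        using wkF[of "Suc k"] carrier_append[of a "b @ word_pow w k" X]
          mult_free_group_reduced[of a "b @ word_pow w k" X]
        unfolding F_def carrier_free_group by auto
      have "y \<otimes>\<^bsub>F\<^esub> \<alpha> [^]\<^bsub>F\<^esub> Suc k = q \<otimes>\<^bsub>F\<^esub> (inv\<^bsub>F\<^esub> a \<otimes>\<^bsub>F\<^esub> ((inv\<^bsub>F\<^esub> h \<otimes>\<^bsub>F\<^esub> h) \<otimes>\<^bsub>F\<^esub> a))
          \<otimes>\<^bsub>F\<^esub> (b @ word_pow w k) \<otimes>\<^bsub>F\<^esub> inv\<^bsub>F\<^esub> h"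
        unfolding y_def pow red using q abF h bk by (simp only: m_assoc m_closed inv_closed)
      also have "\<dots> = q \<otimes>\<^bsub>F\<^esub> (b @ word_pow w k) \<otimes>\<^bsub>F\<^esub> inv\<^bsub>F\<^esub> h"
        using q abF h bk by simp
      finally show "y \<otimes>\<^bsub>F\<^esub> \<alpha> [^]\<^bsub>F\<^esub> Suc k = q \<otimes>\<^bsub>F\<^esub> (b @ word_pow w k) \<otimes>\<^bsub>F\<^esub> inv\<^bsub>F\<^esub> h" .
      have "word_pow w (Suc k) = (word_pow w k @ a) @ b"
        using word_pow_Suc'[where w = w and k = k] ab by simp
      then have ka: "word_pow w k @ a \<in> carrier F"
        using wkF[of "Suc k"] carrier_append[of "word_pow w k @ a" b X] unfolding F_def by simp
      then have kam: "word_pow w k @ a = word_pow w k \<otimes>\<^bsub>F\<^esub> a"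
        unfolding F_def carrier_free_group by (simp add: mult_free_group_reduced)
      have "y \<otimes>\<^bsub>F\<^esub> inv\<^bsub>F\<^esub> (\<alpha> [^]\<^bsub>F\<^esub> k) = q \<otimes>\<^bsub>F\<^esub> inv\<^bsub>F\<^esub> a \<otimes>\<^bsub>F\<^esub> ((inv\<^bsub>F\<^esub> h \<otimes>\<^bsub>F\<^esub> h) \<otimes>\<^bsub>F\<^esub> inv\<^bsub>F\<^esub>
          (word_pow w k)) \<otimes>\<^bsub>F\<^esub> inv\<^bsub>F\<^esub> h"
        unfolding y_def pow using q abF h wkF
          by (simp only: inv_mult_group inv_inv m_assoc m_closed inv_closed)
      also have "\<dots> = q \<otimes>\<^bsub>F\<^esub> inv\<^bsub>F\<^esub> (word_pow w k \<otimes>\<^bsub>F\<^esub> a) \<otimes>\<^bsub>F\<^esub> inv\<^bsub>F\<^esub> h"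
        using q abF h wkF by (simp add: inv_mult_group m_assoc)
      also have "\<dots> = q \<otimes>\<^bsub>F\<^esub> word_inv (word_pow w k @ a) \<otimes>\<^bsub>F\<^esub> inv\<^bsub>F\<^esub> h"
        using inv_free_group[OF ka[unfolded F_def], folded F_def] by (simp only: kam[symmetric])
      finally show "y \<otimes>\<^bsub>F\<^esub> inv\<^bsub>F\<^esub> (\<alpha> [^]\<^bsub>F\<^esub> k) = q \<otimes>\<^bsub>F\<^esub> word_inv (word_pow w k @ a) \<otimes>\<^bsub>F\<^esub> inv\<^bsub>F\<^esub> h" .
    qed
    then show ?thesis using K unfolding f_def by auto
  qed
  \<comment> \<open>Each side is infinite, but only finitely many words are shorter than
    \<open>R\<close>.\<close>
  have long: "\<exists>g\<in>carrier F. R \<le> length g \<and> f g = c" for c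
  proof (rule ccontr)
    assume *: "\<not> ?thesis"
    have "{y \<in> carrier F. starts_left y = c} \<subseteq> (\<lambda>g. g \<otimes>\<^bsub>F\<^esub> inv\<^bsub>F\<^esub> h) ` {g
        \<in> carrier F. length g < R}"
    proof
      fix y assume y: "y \<in> {y \<in> carrier F. starts_left y = c}"
      then have yh: "y = y \<otimes>\<^bsub>F\<^esub> h \<otimes>\<^bsub>F\<^esub> inv\<^bsub>F\<^esub> h" using h by (simp add: m_assoc)
      then have "f (y \<otimes>\<^bsub>F\<^esub> h) = c" using y by (simp add: f_def)
      moreover have "y \<otimes>\<^bsub>F\<^esub> h \<in> carrier F" using y h by simp
      ultimately have "length (y \<otimes>\<^bsub>F\<^esub> h) < R" using * by force
      then show "y \<in> (\<lambda>g. g \<otimes>\<^bsub>F\<^esub> inv\<^bsub>F\<^esub> h) ` {g \<in> carrier F. length g < R}"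
        using yh \<open>y \<otimes>\<^bsub>F\<^esub> h \<in> carrier F\<close> by blast
    qed
    then have "finite {y \<in> carrier F. starts_left y = c}"
      using finite_short_words[OF X(1), of R] unfolding F_def by (auto intro: finite_subset)
    then show False using infinite_starts_left[OF ab, of c] by simp
  qed
  obtain g g' where "g \<in> carrier F" "R \<le> length g" "f g" "g' \<in> carrier F" "R \<le> length g'" "\<not> f g'"
    using long[of True] long[of False] by auto
  then show False
    using constant_at_infinity[where f = f and R = R and g = g and g' = g', OF X(2-4) w(1)] w(2)
      pairs far lines unfolding F_def by blast
qed


section \<open>Generators are separable\<close>

text \<open>The alternating normal form of a word with respect to a partition of the letters groups
  the letters into maximal blocks.\<close>

lemma free_product_words_concat:
  assumes "S \<inter> T = {}"
  shows "ws \<in> free_product_words (free_group (S \<union> T)) (carrier (free_group S)) (carrier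
      (free_group T)) \<Longrightarrow>
    foldr (\<lambda>x y. snd x \<otimes>\<^bsub>free_group (S \<union> T)\<^esub> y) ws [] = concat (map snd ws) \<and>
    reduced (concat (map snd ws)) \<and>
    (ws \<noteq> [] \<longrightarrow> concat (map snd ws) \<noteq> [] \<and>
      fst (hd (concat (map snd ws))) \<in> (if fst (hd ws) then S else T))"
proof (induction ws)
  case (Cons x ws)
  obtain c g where x: "x = (c, g)" by (cases x)
  have "[(c, g)] @ ws \<in> free_product_words (free_group (S \<union> T)) (carrier (free_group S)) (carrier
      (free_group T))"
    using Cons.prems x by simp
  then have g: "g \<noteq> []" "g \<in> (if c then carrier (free_group S) else carrier (free_group T))"
    and ws: "ws \<in> free_product_words (free_group (S \<union> T)) (carrier (free_group S)) (carrier
        (free_group T))"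
    and alt: "ws \<noteq> [] \<Longrightarrow> c \<noteq> fst (hd ws)"
    unfolding free_product_words_append free_product_words_single by (auto simp: one_free_group)
  have gr: "reduced g" "\<forall>l\<in>set g. fst l \<in> (if c then S else T)"
    using g(2) by (auto simp: carrier_free_group split: if_splits)
  note IH = Cons.IH[OF ws]
  have "reduced (g @ concat (map snd ws))"
  proof (cases "ws = []")
    case False
    \<comment> \<open>Neighbouring blocks use disjoint sets of generators, so nothing cancels where
      they meet.\<close>
    have "fst (last g) \<in> (if c then S else T)" using gr(2) g(1) by simp
    moreover have "fst (hd (concat (map snd ws))) \<in> (if c then T else S)"
      using IH False alt by (cases c; cases "fst (hd ws)") auto
    ultimately have "fst (hd (concat (map snd ws))) \<noteq> fst (last g)" using assms
      by (auto split: if_splits)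
    then have "hd (concat (map snd ws)) \<noteq> inv_letter (last g)" by (metis fst_inv_letter)
    then show ?thesis using IH gr(1) by (simp add: reduced_append)
  qed (use gr in simp)
  moreover from this have "g \<otimes>\<^bsub>free_group (S \<union> T)\<^esub> concat (map snd ws) = g @ concat (map snd ws)"
    by (rule mult_free_group_reduced)
  moreover have "fst (hd g) \<in> (if c then S else T)" using gr(2) g(1) by simp
  ultimately show ?case using IH g(1) by (simp add: x)
qed simp

text \<open>The first block can be recovered: its first letter tells the factor, and the block is
  the longest prefix with letters from that factor.\<close>

lemma free_product_words_concat_inj:
  assumes "S \<inter> T = {}"
  defines "W \<equiv> free_product_words (free_group (S \<union> T)) (carrier (free_group S)) (carrier
      (free_group T))"
  shows "ws \<in> W \<Longrightarrow> vs \<in> W \<Longrightarrow> concat (map snd ws) = concat (map snd vs) \<Longrightarrow> ws = vs"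
proof (induction ws arbitrary: vs)
  case Nil
  then show ?case using free_product_words_concat[OF assms(1), of vs] by (auto simp: W_def)
next
  case (Cons x ws)
  have first_block: "takeWhile (\<lambda>l. fst l \<in> (if c then S else T)) (concat (map snd ((c, g) # us)))
      = g \<and>
      us \<in> W \<and> (c \<longleftrightarrow> fst (hd (concat (map snd ((c, g) # us)))) \<in> S)"
    if us: "(c, g) # us \<in> W" for c g us
  proof -
    have "[(c, g)] @ us \<in> W" using us by simp
    then have g: "g \<noteq> []" "g \<in> (if c then carrier (free_group S) else carrier (free_group T))"
      and uw: "us \<in> W" and alt: "us \<noteq> [] \<Longrightarrow> c \<noteq> fst (hd us)"
      unfolding W_def free_product_words_append free_product_words_single
        by (auto simp: one_free_group)
    have gr: "\<forall>l\<in>set g. fst l \<in> (if c then S else T)"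
      using g(2) by (auto simp: carrier_free_group split: if_splits)
    have "takeWhile (\<lambda>l. fst l \<in> (if c then S else T)) (concat (map snd us)) = []"
    proof (cases "us = []")
      case False
      have "fst (hd (concat (map snd us))) \<in> (if c then T else S)" "concat (map snd us) \<noteq> []"
        using free_product_words_concat[OF assms(1), of us] uw False alt
        by (cases c; cases "fst (hd us)"; auto simp: W_def)+
      then have "fst (hd (concat (map snd us))) \<notin> (if c then S else T)"
        using assms(1) by (auto split: if_splits)
      then show ?thesis using takeWhile_eq_Nil_iff by blast
    qed simp
    then have "takeWhile (\<lambda>l. fst l \<in> (if c then S else T)) (concat (map snd ((c, g) # us))) = g"
      using gr by (simp add: takeWhile_append2)
    moreover have "fst (hd g) \<in> (if c then S else T)" using gr g(1) by simp
    ultimately show ?thesis using uw g(1) assms(1) by (auto split: if_splits)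
  qed
  obtain c g where x: "x = (c, g)" by (cases x)
  have "concat (map snd (x # ws)) \<noteq> []"
    using free_product_words_concat[OF assms(1) Cons.prems(1)[unfolded W_def]]
      list.distinct(2)[of x ws]
    by blast
  then have "concat (map snd vs) \<noteq> []" unfolding Cons.prems(3) .
  then have "vs \<noteq> []" by auto
  then obtain d h us where vs: "vs = (d, h) # us" by (metis neq_Nil_conv surj_pair)
  note 1 = first_block[OF Cons.prems(1)[unfolded x]]
    and 2 = first_block[OF Cons.prems(2)[unfolded vs]]
  have eq: "concat (map snd ((c, g) # ws)) = concat (map snd ((d, h) # us))"
    using Cons.prems(3) unfolding x vs .
  have "c = d" using 1 2 unfolding eq by blast
  moreover from this have "g = h" using 1 2 unfolding eq by blast
  moreover from this have "ws = us" using Cons.IH[of us] 1 2 eq by simp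
  ultimately show ?case by (simp add: x vs)
qed

text \<open>When a word is read from the right, each new letter either extends the first block or
  opens a new one.\<close>

lemma free_product_words_concat_surj:
  assumes "S \<inter> T = {}"
  defines "W \<equiv> free_product_words (free_group (S \<union> T)) (carrier (free_group S)) (carrier
      (free_group T))"
  shows "w \<in> carrier (free_group (S \<union> T)) \<Longrightarrow> \<exists>ws\<in>W. concat (map snd ws) = w"
proof (induction w)
  case Nil
  show ?case by (intro bexI[of _ "[]"]) (auto simp: W_def free_product_words_def)
next
  case (Cons a w)
  have a: "fst a \<in> S \<union> T" and w: "w \<in> carrier (free_group (S \<union> T))" and red: "reduced (a # w)"
    using Cons.prems by (auto simp: carrier_free_group reduced_Cons)
  obtain ws where ws: "ws \<in> W" "concat (map snd ws) = w" using Cons.IH[OF w] by blast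
  define c where "c \<longleftrightarrow> fst a \<in> S"
  have ac: "fst a \<in> (if c then S else T)" using a by (auto simp: c_def)
  have a1: "[(c, [a])] \<in> W"
    using ac unfolding W_def free_product_words_single
    by (auto simp: one_free_group carrier_free_group reduced_Cons split: if_splits)
  show ?case
  proof (cases "ws \<noteq> [] \<and> fst (hd ws) = c")
    case False
    then have "[(c, [a])] @ ws \<in> W"
      using a1 ws(1) unfolding W_def free_product_words_append by auto
    moreover have "concat (map snd ([(c, [a])] @ ws)) = a # w" using ws by simp
    ultimately show ?thesis by blast
  next
    case True
    then obtain g us where us: "ws = (c, g) # us" by (cases ws; cases "hd ws") auto
    have "[(c, g)] @ us \<in> W" using ws us by simp
    then have g: "g \<noteq> []" "g \<in> (if c then carrier (free_group S) else carrier (free_group T))"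
      and uw: "us \<in> W" and alt: "us \<noteq> [] \<Longrightarrow> c \<noteq> fst (hd us)"
      unfolding W_def free_product_words_append free_product_words_single
        by (auto simp: one_free_group)
    have w: "w = g @ concat (map snd us)" using ws us by simp
    have "reduced (a # g)" using red unfolding w by (simp add: reduced_Cons reduced_append g(1))
    then have "[(c, a # g)] @ us \<in> W"
      using g ac uw alt unfolding W_def free_product_words_append free_product_words_single
      by (auto simp: one_free_group carrier_free_group split: if_splits)
    moreover have "concat (map snd ([(c, a # g)] @ us)) = a # w" by (simp add: w)
    ultimately show ?thesis by blast
  qed
qed

text \<open>On alternating words the product in the group is plain concatenation, so the bijection
  with reduced words carries over.\<close>

lemma is_free_product_free_group:
  assumes "S \<inter> T = {}"
  shows "is_free_product (free_group (S \<union> T)) (carrier (free_group S)) (carrier (free_group T))"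
proof -
  have sub: "subgroup (carrier (free_group Y)) (free_group (S \<union> T))" if "Y \<subseteq> S \<union> T" for Y
  proof (rule group.subgroupI[OF group_free_group])
    interpret Y: group "free_group Y" by (rule group_free_group)
    show Y: "carrier (free_group Y) \<subseteq> carrier (free_group (S \<union> T))"
      using that by (intro subsetI) (auto simp only: carrier_free_group intro: subset_trans)
    show "inv\<^bsub>free_group (S \<union> T)\<^esub> a \<in> carrier (free_group Y)" if "a \<in> carrier (free_group Y)" for a
      using Y.inv_closed[OF that] inv_free_group[OF that] inv_free_group[OF subsetD[OF Y that]]
        by simp
    show "a \<otimes>\<^bsub>free_group (S \<union> T)\<^esub> b \<in> carrier (free_group Y)"
      if "a \<in> carrier (free_group Y)" "b \<in> carrier (free_group Y)" for a b
      using Y.m_closed[OF that] by (simp add: mult_free_group)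
    show "carrier (free_group Y) \<noteq> {}" using Y.one_closed by blast
  qed
  let ?W = "free_product_words (free_group (S \<union> T)) (carrier (free_group S)) (carrier (free_group
      T))"
  have in_carrier: "concat (map snd ws) \<in> carrier (free_group (S \<union> T))" if "ws \<in> ?W" for ws
  proof -
    have "fst l \<in> S \<union> T" if l: "l \<in> set (concat (map snd ws))" for l
    proof -
      obtain c g where "(c, g) \<in> set ws" "l \<in> set g" using l by auto
      then have "g \<in> (if c then carrier (free_group S) else carrier (free_group T))"
        using \<open>ws \<in> ?W\<close> unfolding free_product_words_def by auto
      then show ?thesis using \<open>l \<in> set g\<close> by (auto simp: carrier_free_group split: if_splits)
    qed
    then show ?thesis
      using free_product_words_concat[OF assms that] unfolding carrier_free_group by blast
  qed
  have "bij_betw (\<lambda>ws. concat (map snd ws)) ?W (carrier (free_group (S \<union> T)))"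
    unfolding bij_betw_def
  proof
    show "inj_on (\<lambda>ws. concat (map snd ws)) ?W"
      using free_product_words_concat_inj[OF assms] by (rule inj_onI)
    show "(\<lambda>ws. concat (map snd ws)) ` ?W = carrier (free_group (S \<union> T))"
      using in_carrier free_product_words_concat_surj[OF assms] by blast
  qed
  then have "bij_betw (\<lambda>ws. foldr (\<lambda>x y. snd x \<otimes>\<^bsub>free_group (S \<union> T)\<^esub> y) ws \<one>\<^bsub>free_group (S \<union> T)\<^esub>)
      ?W (carrier (free_group (S \<union> T)))"
    by (rule iffD1[OF bij_betw_cong, rotated])
      (simp add: one_free_group free_product_words_concat[OF assms])
  then show ?thesis unfolding is_free_product_def using sub by simp
qed

text \<open>Split off the generator \<open>x\<close> as a free factor; \<open>y\<close> keeps the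
  complementary factor nontrivial.\<close>

lemma separable_generator:
  assumes "x \<in> X" "y \<in> X" "x \<noteq> y"
  shows "separable (free_group X) [(x, e)]"
proof -
  let ?A = "carrier (free_group {x})" and ?B = "carrier (free_group (X - {x}))"
  have X: "X = {x} \<union> (X - {x})" using assms by auto
  have "is_free_product (free_group ({x} \<union> (X - {x}))) ?A ?B"
    by (rule is_free_product_free_group) auto
  then have fp: "is_free_product (free_group X) ?A ?B" using X by simp
  have mem: "[(x, True)] \<in> ?A" "[(y, True)] \<in> ?B" "[(x, True)] \<in> carrier (free_group X)"
    "[(y, True)] \<in> carrier (free_group X)" "[(x, True)] \<notin> ?B" "[(y, True)] \<notin> ?A"
    using assms by (auto simp: carrier_free_group reduced_Cons)
  have "nontrivial_proper_subgroup (free_group X) ?A" "nontrivial_proper_subgroup (free_group X) ?B"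
    using fp mem unfolding nontrivial_proper_subgroup_def is_free_product_def one_free_group by auto
  then have "proper_free_factor (free_group X) ?A" using fp unfolding proper_free_factor_def
    by blast
  moreover have "[(x, e)] \<in> ?A" by (simp add: carrier_free_group reduced_Cons)
  ultimately show ?thesis unfolding separable_def by blast
qed


section \<open>The separability complex\<close>

lemma (in group) conj_class_self: "g \<in> carrier G \<Longrightarrow> g \<in> conj_class G g"
  unfolding conj_class_def by (auto intro: exI[of _ \<one>])

lemma (in group) conj_class_conj:
  assumes "k \<in> carrier G" "g \<in> carrier G"
  shows "conj_class G (k \<otimes> g \<otimes> inv k) = conj_class G g"
proof (intro equalityI subsetI)
  fix y assume "y \<in> conj_class G (k \<otimes> g \<otimes> inv k)"
  then obtain h where "h \<in> carrier G" "y = h \<otimes> (k \<otimes> g \<otimes> inv k) \<otimes> inv h"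
    unfolding conj_class_def by blast
  then have "h \<otimes> k \<in> carrier G" "y = (h \<otimes> k) \<otimes> g \<otimes> inv (h \<otimes> k)"
    using assms by (simp_all add: inv_mult_group m_assoc)
  then show "y \<in> conj_class G g" unfolding conj_class_def by blast
next
  fix y assume "y \<in> conj_class G g"
  then obtain h where h: "h \<in> carrier G" "y = h \<otimes> g \<otimes> inv h"
    unfolding conj_class_def by blast
  have "(h \<otimes> inv k) \<otimes> (k \<otimes> g \<otimes> inv k) \<otimes> inv (h \<otimes> inv k)
      = h \<otimes> (inv k \<otimes> k) \<otimes> g \<otimes> (inv k \<otimes> k) \<otimes> inv h"
    using assms h(1) by (simp only: inv_mult_group inv_inv m_assoc m_closed inv_closed)
  then have "y = (h \<otimes> inv k) \<otimes> (k \<otimes> g \<otimes> inv k) \<otimes> inv (h \<otimes> inv k)"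
    using assms h by simp
  then show "y \<in> conj_class G (k \<otimes> g \<otimes> inv k)"
    unfolding conj_class_def using assms h(1) by blast
qed

text \<open>Conjugation by \<open>g\<close> turns one product into the other. Edges multiply on the
  right; for classes this makes left multiplication available as well.\<close>

lemma (in group) conj_class_commute:
  assumes "g \<in> carrier G" "h \<in> carrier G"
  shows "conj_class G (g \<otimes> h) = conj_class G (h \<otimes> g)"
  using conj_class_conj[of g "h \<otimes> g"] assms by (simp add: m_assoc)

lemma (in group) separable_inv:
  assumes "separable G g"
  shows "separable G (inv g)"
  using assms unfolding separable_def proper_free_factor_def nontrivial_proper_subgroup_def
  by (meson subgroup.m_inv_closed)

lemma adjacent_mult_generator:
  assumes "x1 \<in> X" "x2 \<in> X" "x1 \<noteq> x2" "g \<in> carrier (free_group X)" "fst z \<in> X"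
  shows "adjacent (sep_complex (free_group X)) (conj_class (free_group X) g)
    (conj_class (free_group X) (g \<otimes>\<^bsub>free_group X\<^esub> [z]))"
proof -
  interpret group "free_group X" by (rule group_free_group)
  have z: "[z] \<in> carrier (free_group X)" using assms by (simp add: carrier_free_group)
  obtain y where "y \<in> X" "fst z \<noteq> y" using assms by metis
  then have "separable (free_group X) [z]"
    using separable_generator[of "fst z" X y "snd z"] assms by simp
  moreover have "\<exists>v\<in>conj_class (free_group X) g. \<exists>\<alpha>\<in>conj_class (free_group X) [z].
      \<exists>w\<in>conj_class (free_group X) (g \<otimes>\<^bsub>free_group X\<^esub> [z]). w = v \<otimes>\<^bsub>free_group X\<^esub> \<alpha>"
    using conj_class_self[OF assms(4)] conj_class_self[OF z] conj_class_self[OF m_closed[OF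
      assms(4) z]]
    by blast
  ultimately have "(conj_class (free_group X) g, conj_class (free_group X) [z],
      conj_class (free_group X) (g \<otimes>\<^bsub>free_group X\<^esub> [z])) \<in> arcs (sep_complex (free_group X))"
    using assms(4) z by (simp add: sep_complex_def one_free_group)
  then show ?thesis
    unfolding adjacent_def by (rule bexI[rotated]) (simp add: sep_complex_def)
qed

text \<open>The letters of \<open>u\<close> are separable, so appending them one by one walks along
  \<open>length u\<close> edges. This gives connectedness and the upper bounds on distances.\<close>

lemma adjacent_pow_mult:
  assumes X: "x1 \<in> X" "x2 \<in> X" "x1 \<noteq> x2" and g: "g \<in> carrier (free_group X)"
  shows "u \<in> carrier (free_group X) \<Longrightarrow> (adjacent (sep_complex (free_group X)) ^^ length u)
    (conj_class (free_group X) g) (conj_class (free_group X) (g \<otimes>\<^bsub>free_group X\<^esub> u))"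
proof (induction u rule: rev_induct)
  interpret group "free_group X" by (rule group_free_group)
  {
    case Nil
    then show ?case using r_one[OF g, unfolded one_free_group] by simp
  next
    case (snoc z u)
    have u: "u \<in> carrier (free_group X)" "[z] \<in> carrier (free_group X)"
      using carrier_append[OF snoc.prems] by auto
    have "u @ [z] = u \<otimes>\<^bsub>free_group X\<^esub> [z]"
      using snoc.prems by (simp add: mult_free_group_reduced carrier_free_group)
    then have e: "g \<otimes>\<^bsub>free_group X\<^esub> (u @ [z]) = g \<otimes>\<^bsub>free_group X\<^esub> u \<otimes>\<^bsub>free_group X\<^esub> [z]"
      using g u by (simp add: m_assoc)
    have "fst z \<in> X" using u(2) by (simp add: carrier_free_group)
    then have "adjacent (sep_complex (free_group X)) (conj_class (free_group X) (g \<otimes>\<^bsub>free_group X\<^esub>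
        u))
        (conj_class (free_group X) (g \<otimes>\<^bsub>free_group X\<^esub> (u @ [z])))"
      unfolding e by (rule adjacent_mult_generator[OF X m_closed[OF g u(1)]])
    then show ?case using snoc.IH[OF u(1)] by (auto intro: relpowp_Suc_I)
  }
qed

lemma connected_graph_sep_complex:
  assumes "x1 \<in> X" "x2 \<in> X" "x1 \<noteq> x2"
  shows "connected_graph (sep_complex (free_group X))"
proof (rule connected_graph.intro[OF wf_digraph_sep_complex], unfold_locales)
  interpret group "free_group X" by (rule group_free_group)
  fix V W assume "V \<in> verts (sep_complex (free_group X))" "W \<in> verts (sep_complex (free_group X))"
  then obtain v w where vw: "v \<in> carrier (free_group X)" "w \<in> carrier (free_group X)"
    "V = conj_class (free_group X) v" "W = conj_class (free_group X) w"
    by (auto simp: sep_complex_def)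
  have "v \<otimes>\<^bsub>free_group X\<^esub> (inv\<^bsub>free_group X\<^esub> v \<otimes>\<^bsub>free_group X\<^esub> w) = w"
    using vw by (simp flip: m_assoc)
  then show "\<exists>k. (adjacent (sep_complex (free_group X)) ^^ k) V W"
    using adjacent_pow_mult[OF assms vw(1), of "inv\<^bsub>free_group X\<^esub> v \<otimes>\<^bsub>free_group X\<^esub> w"] vw by auto
qed

text \<open>A cyclically reduced conjugate of \<alpha> omits some pair and therefore
  \<open>u\<close>; the same for the inverse of \<alpha> excludes \<open>word_inv u\<close>. So its
  count is zero, and the bound is the cost of the conjugation.\<close>

lemma counting_separable:
  assumes X: "finite X" "x1 \<in> X" "x2 \<in> X" "x1 \<noteq> x2"
    and u: "\<And>x y. x \<in> X \<Longrightarrow> y \<in> X \<Longrightarrow> \<exists>a b. u = a @ [(x, True), (y, True)] @ b"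
    and \<alpha>: "\<alpha> \<in> carrier (free_group X)" "separable (free_group X) \<alpha>"
  shows "\<bar>counting u \<alpha>\<bar> \<le> 6 * length u"
proof -
  interpret group "free_group X" by (rule group_free_group)
  have u0: "u \<noteq> []" using u[OF X(2,3)] by auto
  obtain h w where hw: "\<alpha> = h @ w @ word_inv h" "cyclically_reduced w"
    using cyclic_reduction[of \<alpha>] \<alpha>(1) by (auto simp: carrier_free_group)
  have h: "h \<in> carrier (free_group X)" and w: "w \<in> carrier (free_group X)"
    using \<alpha>(1) carrier_append unfolding hw(1) by blast+
  have "h @ w \<in> carrier (free_group X)"
    using \<alpha>(1) carrier_append[of "h @ w" "word_inv h" X] unfolding hw(1) by simp
  then have "h \<otimes>\<^bsub>free_group X\<^esub> w = h @ w"
    by (simp add: mult_free_group_reduced carrier_free_group)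
  moreover have "(h @ w) \<otimes>\<^bsub>free_group X\<^esub> word_inv h = \<alpha>"
    using \<alpha>(1) by (simp add: mult_free_group_reduced carrier_free_group hw(1))
  ultimately have \<alpha>_conj: "\<alpha> = h \<otimes>\<^bsub>free_group X\<^esub> w \<otimes>\<^bsub>free_group X\<^esub> inv\<^bsub>free_group X\<^esub> h"
    using inv_free_group[OF h] by simp
  \<comment> \<open>Stated for a general \<open>v\<close>, to be applied to both \<open>w\<close>
    and \<open>word_inv w\<close>.\<close>
  have avoid: "occurrences u v = 0" if v: "cyclically_reduced v" "v \<in> carrier (free_group X)"
    "separable (free_group X) (h \<otimes>\<^bsub>free_group X\<^esub> v \<otimes>\<^bsub>free_group X\<^esub> inv\<^bsub>free_group X\<^esub> h)" for v
  proof (rule occurrences_eq_0, rule notI)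
    assume "\<exists>p s. v = p @ u @ s"
    then obtain p s where ps: "v = p @ u @ s" by blast
    obtain x y where xy: "x \<in> X" "y \<in> X" "\<nexists>a b. v = a @ [(x, True), (y, True)] @ b"
      using separable_word_avoids_pair[OF X v(1,2) h v(3)] by blast
    obtain a b where "u = a @ [(x, True), (y, True)] @ b" using u[OF xy(1,2)] by blast
    then have "v = (p @ a) @ [(x, True), (y, True)] @ (b @ s)" using ps by simp
    then show False using xy(3) by blast
  qed
  have "occurrences u w = 0" using avoid[OF hw(2) w] \<alpha>(2) unfolding \<alpha>_conj by simp
  moreover have "occurrences (word_inv u) w = 0"
  proof -
    have "inv\<^bsub>free_group X\<^esub> \<alpha> = h \<otimes>\<^bsub>free_group X\<^esub> word_inv w \<otimes>\<^bsub>free_group X\<^esub> inv\<^bsub>free_group X\<^esub> h"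
      unfolding \<alpha>_conj inv_free_group[OF w, symmetric] using h w
        by (simp add: inv_mult_group m_assoc)
    then have "occurrences u (word_inv w) = 0"
      using avoid[OF cyclically_reduced_word_inv[OF hw(2)]] separable_inv[OF \<alpha>(2)] w
      by (simp add: carrier_free_group)
    then show ?thesis using occurrences_word_inv[of "word_inv u" w] by simp
  qed
  ultimately have "counting u w = 0" by (simp add: counting_def)
  then show ?thesis using counting_conj[OF u0 h w] unfolding \<alpha>_conj by simp
qed

lemma counting_conj_class:
  assumes "u \<noteq> []" "g \<in> carrier (free_group X)" "g' \<in> conj_class (free_group X) g"
  shows "g' \<in> carrier (free_group X)" "\<bar>counting u g' - counting u g\<bar> \<le> 6 * length u"
proof -
  interpret group "free_group X" by (rule group_free_group)
  obtain h where h: "h \<in> carrier (free_group X)"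
    "g' = h \<otimes>\<^bsub>free_group X\<^esub> g \<otimes>\<^bsub>free_group X\<^esub> inv\<^bsub>free_group X\<^esub> h"
    using assms(3) unfolding conj_class_def by blast
  then show "g' \<in> carrier (free_group X)" using assms(2) by simp
  show "\<bar>counting u g' - counting u g\<bar> \<le> 6 * length u"
    unfolding h(2) by (rule counting_conj[OF assms(1) h(1) assms(2)])
qed

text \<open>The 27 consists of 6 for the separable label, 6 for each of three changes of
  representative in a conjugacy class, and 3 for the product.\<close>

lemma counting_adjacent:
  assumes X: "finite X" "x1 \<in> X" "x2 \<in> X" "x1 \<noteq> x2"
    and u: "\<And>x y. x \<in> X \<Longrightarrow> y \<in> X \<Longrightarrow> \<exists>a b. u = a @ [(x, True), (y, True)] @ b"
    and v: "v \<in> carrier (free_group X)" and w: "w \<in> carrier (free_group X)"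
    and adj: "adjacent (sep_complex (free_group X)) (conj_class (free_group X) v) (conj_class
        (free_group X) w)"
  shows "\<bar>counting u v - counting u w\<bar> \<le> 27 * length u"
proof -
  interpret group "free_group X" by (rule group_free_group)
  have u0: "u \<noteq> []" using u[OF X(2,3)] by auto
  have arc: "\<bar>counting u v - counting u w\<bar> \<le> 27 * length u"
    if vw: "v \<in> carrier (free_group X)" "w \<in> carrier (free_group X)"
      and L: "(conj_class (free_group X) v, L, conj_class (free_group X) w)
          \<in> arcs (sep_complex (free_group X))" for v w L
  proof -
    obtain \<alpha> v1 \<alpha>1 w1 where \<alpha>: "\<alpha> \<in> carrier (free_group X)" "separable (free_group X) \<alpha>"
      and v1: "v1 \<in> conj_class (free_group X) v" and \<alpha>1: "\<alpha>1 \<in> conj_class (free_group X) \<alpha>"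
      and w1: "w1 \<in> conj_class (free_group X) w" "w1 = v1 \<otimes>\<^bsub>free_group X\<^esub> \<alpha>1"
      using L by (auto simp: sep_complex_def)
    have "\<bar>counting u \<alpha>\<bar> \<le> 6 * length u" by (rule counting_separable[OF X u \<alpha>])
    moreover note counting_conj_class(2)[OF u0 vw(1) v1] counting_conj_class(2)[OF u0 vw(2) w1(1)]
      counting_conj_class(2)[OF u0 \<alpha>(1) \<alpha>1]
    moreover have "\<bar>counting u w1 - counting u v1 - counting u \<alpha>1\<bar> \<le> 3 * length u"
      unfolding w1(2) using counting_conj_class(1)[OF u0 vw(1) v1] counting_conj_class(1)[OF u0
        \<alpha>(1) \<alpha>1]
      by (rule counting_mult[OF u0])
    ultimately show ?thesis by linarith
  qed
  have ends: "tail (sep_complex (free_group X)) = fst" "head (sep_complex (free_group X))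
      = snd \<circ> snd"
    by (simp_all add: sep_complex_def)
  obtain e where "e \<in> arcs (sep_complex (free_group X))"
    "fst e = conj_class (free_group X) v \<and> snd (snd e) = conj_class (free_group X) w \<or>
     fst e = conj_class (free_group X) w \<and> snd (snd e) = conj_class (free_group X) v"
    using adj unfolding adjacent_def ends o_apply by blast
  then show ?thesis
    using arc[OF v w, of "fst (snd e)"] arc[OF w v, of "fst (snd e)"]
    by (metis abs_minus_commute prod.collapse)
qed

text \<open>The additive term accounts for \<open>k = 0\<close>, where \<open>v\<close> and
  \<open>w\<close> may still be different representatives of one class.\<close>

lemma counting_adjacent_pow:
  assumes X: "finite X" "x1 \<in> X" "x2 \<in> X" "x1 \<noteq> x2"
    and u: "\<And>x y. x \<in> X \<Longrightarrow> y \<in> X \<Longrightarrow> \<exists>a b. u = a @ [(x, True), (y, True)] @ b"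
    and v: "v \<in> carrier (free_group X)"
  shows "w \<in> carrier (free_group X) \<Longrightarrow> (adjacent (sep_complex (free_group X)) ^^ k)
      (conj_class (free_group X) v) (conj_class (free_group X) w) \<Longrightarrow>
    \<bar>counting u v - counting u w\<bar> \<le> 27 * length u * k + 6 * length u"
proof (induction k arbitrary: w)
  case 0
  interpret group "free_group X" by (rule group_free_group)
  have u0: "u \<noteq> []" using u[OF X(2,3)] by auto
  have "v \<in> conj_class (free_group X) w" using conj_class_self[OF v] 0 by simp
  then show ?case using counting_conj_class(2)[OF u0 0(1)] by simp
next
  case (Suc k)
  obtain W where W: "(adjacent (sep_complex (free_group X)) ^^ k) (conj_class (free_group X) v) W"
    "adjacent (sep_complex (free_group X)) W (conj_class (free_group X) w)"
    using Suc.prems(2) by (rule relpowp_Suc_E)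
  obtain w' where w': "w' \<in> carrier (free_group X)" "W = conj_class (free_group X) w'"
    using W(2) unfolding adjacent_def by (auto simp: sep_complex_def)
  show ?case
    using Suc.IH[OF w'(1)] W w' counting_adjacent[OF X u w'(1) Suc.prems(1)]
    by (fastforce simp: algebra_simps)
qed

section \<open>Positive words and the two markers\<close>

definition positive :: "'a list \<Rightarrow> 'a letter list" where
  "positive w = map (\<lambda>x. (x, True)) w"

lemma positive_append: "positive (v @ w) = positive v @ positive w"
  by (simp add: positive_def)

lemma word_pow_positive: "word_pow (positive w) k = positive (word_pow w k)"
  by (simp add: positive_def map_concat)

lemma cyclically_reduced_positive: "cyclically_reduced (positive w)"
proof -
  have "reduced (positive w)"
    by (induction w) (auto simp: positive_def reduced_Cons hd_map inv_letter_def)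
  then show ?thesis
    unfolding cyclically_reduced_def by (auto simp: positive_def hd_map last_map inv_letter_def)
qed

lemma positive_carrier: "set w \<subseteq> X \<Longrightarrow> positive w \<in> carrier (free_group X)"
  using cyclically_reduced_positive[of w]
  by (auto simp: carrier_free_group cyclically_reduced_def) (auto simp: positive_def)

lemma occurrences_word_inv_positive:
  assumes "u \<noteq> []"
  shows "occurrences (word_inv (positive u)) (positive v) = 0"
proof (rule occurrences_eq_0, rule notI)
  assume "\<exists>p s. positive v = p @ word_inv (positive u) @ s"
  then have "set (word_inv (positive u)) \<subseteq> set (positive v)" by auto
  then show False using assms by (cases u) (auto simp: positive_def inv_letter_def)
qed

text \<open>Each further factor \<open>u\<close> brings an occurrence of its own; those that
  straddle two factors only add to the count.\<close>

lemma occurrences_pow_ge: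
  assumes "u \<noteq> []"
  shows "occurrences u (word_pow u i) + k \<le> occurrences u (word_pow u (i + k))"
proof (induction k)
  case (Suc k)
  have "p = [] \<and> s = []" if "u = p @ u @ s" for p s
    using arg_cong[OF that, of length] by simp
  then have "{(p, s). u = p @ u @ s} = {([], [])}" by auto
  then have "occurrences u u = 1" by (simp add: occurrences_def)
  then show ?case
    using Suc occurrences_append_ge[OF assms, of "word_pow u (i + k)" u]
    by (simp only: add_Suc_right word_pow_Suc')
qed simp

lemma nth_word_pow: "i < k * length w \<Longrightarrow> word_pow w k ! i = w ! (i mod length w)"
proof (induction k arbitrary: i)
  case (Suc k)
  then show ?case by (cases "i < length w") (auto simp: nth_append le_mod_geq)
qed simp

text \<open>The initial run of \<open>x\<close> is longer than \<open>ps\<close>, so it cannot occur in the powers of the marker of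
  another letter.\<close>

definition marker :: "'a list \<Rightarrow> 'a \<Rightarrow> 'a list" where
  "marker ps x = replicate (Suc (length ps)) x @ ps"

lemma length_marker: "length (marker ps x) = Suc (2 * length ps)"
  by (simp add: marker_def)

text \<open>The word has period \<open>Suc (2 * length ps)\<close>, and in each period
  \<open>ps\<close> occupies only \<open>length ps\<close> consecutive places. So every window of
  \<open>Suc (length ps)\<close> letters meets a run of \<open>y\<close>.\<close>

lemma no_long_run:
  assumes "x \<noteq> y" "word_pow (marker ps y) k = p @ replicate (Suc (length ps)) x @ s"
  shows False
proof -
  let ?l = "length ps" let ?w = "marker ps y" let ?r = "length p mod length ?w"
  have r: "?r < Suc (2 * ?l)" by (simp add: length_marker)
  \<comment> \<open>The first place in the window whose residue is at most \<open>?l\<close>; from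
    within \<open>ps\<close> it is the start of the next period.\<close>
  define t where "t = (if ?r \<le> ?l then 0 else Suc (2 * ?l) - ?r)"
  have t: "t \<le> ?l" using r by (auto simp: t_def)
  have "(length p + t) mod length ?w = (?r + t) mod length ?w" by (simp add: mod_add_left_eq)
  also have "\<dots> \<le> ?l" using r by (auto simp: t_def length_marker)
  finally have m: "(length p + t) mod length ?w \<le> ?l" .
  have "length p + t < length (word_pow ?w k)" using t unfolding assms(2) by simp
  then have "word_pow ?w k ! (length p + t) = ?w ! ((length p + t) mod length ?w)"
    by (intro nth_word_pow) (simp add: length_word_pow)
  also have "\<dots> = y"
  proof -
    have "?w ! i = y" if "i \<le> ?l" for i
      using that by (simp add: marker_def nth_append del: replicate_Suc)
    then show ?thesis using m by blast
  qed
  finally have "word_pow ?w k ! (length p + t) = y" .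
  moreover have "word_pow ?w k ! (length p + t) = x"
    using t unfolding assms(2) by (simp add: nth_append del: replicate_Suc)
  ultimately show False using assms(1) by simp
qed

lemma occurrences_other_marker:
  assumes "x \<noteq> y"
  shows "occurrences (positive (marker ps x)) (positive (word_pow (marker ps y) k)) = 0"
proof (rule occurrences_eq_0, rule notI)
  assume "\<exists>p s. positive (word_pow (marker ps y) k) = p @ positive (marker ps x) @ s"
  then obtain p s where "positive (word_pow (marker ps y) k) = p @ positive (marker ps x) @ s"
    by blast
  then have "map fst (positive (word_pow (marker ps y) k)) = map fst (p @ positive (marker ps x) @
      s)"
    by simp
  then have "word_pow (marker ps y) k = map fst p @ replicate (Suc (length ps)) x @ (ps @ map fst
      s)"
    by (simp add: positive_def marker_def o_def)
  then show False using no_long_run assms by metis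
qed

text \<open>The power of \<open>v\<close> counts as zero and that of \<open>u\<close> grows with the
  exponent; the concatenations cost \<open>length u\<close> for each of the two words compared. Both
  orders appear because exchanging the two markers yields the second coordinate.\<close>

lemma counting_marker_ge:
  fixes x y :: 'a and ps :: "'a list"
  assumes "x \<noteq> y"
  defines "u \<equiv> positive (marker ps x)" and "v \<equiv> positive (marker ps y)"
  shows "\<bar>int i - int k\<bar> \<le> \<bar>counting u (word_pow u i @ word_pow v j) - counting u (word_pow u k @
      word_pow v l)\<bar>
    + 2 * length u"
    and "\<bar>int i - int k\<bar> \<le> \<bar>counting u (word_pow v j @ word_pow u i) - counting u (word_pow v l @
        word_pow u k)\<bar>
    + 2 * length u"
proof -
  have u0: "u \<noteq> []" by (simp add: u_def positive_def marker_def)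
  have cu: "counting u (word_pow u i) = occurrences u (word_pow u i)" for i
    unfolding counting_def u_def word_pow_positive
    by (simp add: occurrences_word_inv_positive marker_def)
  have cv: "counting u (word_pow v j) = 0" for j
    unfolding counting_def u_def v_def word_pow_positive
    using occurrences_other_marker[OF assms(1)]
      by (simp add: occurrences_word_inv_positive marker_def)
  have "\<bar>int i - int k\<bar> \<le> \<bar>counting u (word_pow u i) - counting u (word_pow u k)\<bar>"
    unfolding cu using occurrences_pow_ge[OF u0, of i "k - i"] occurrences_pow_ge[OF u0, of k
      "i - k"]
    by (cases "i \<le> k") auto
  then show "\<bar>int i - int k\<bar> \<le> \<bar>counting u (word_pow u i @ word_pow v j) - counting u (word_pow u
      k @ word_pow v l)\<bar>
    + 2 * length u"
    and "\<bar>int i - int k\<bar> \<le> \<bar>counting u (word_pow v j @ word_pow u i) - counting u (word_pow v l @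
        word_pow u k)\<bar>
    + 2 * length u"
    using counting_append[OF u0, of "word_pow u i" "word_pow v j"] cv[of j]
      counting_append[OF u0, of "word_pow u k" "word_pow v l"] cv[of l]
      counting_append[OF u0, of "word_pow v j" "word_pow u i"]
      counting_append[OF u0, of "word_pow v l" "word_pow u k"]
    by linarith+
qed

lemma list_of_pairs:
  assumes "finite X"
  obtains ps where "set ps \<subseteq> X" "\<And>x y. x \<in> X \<Longrightarrow> y \<in> X \<Longrightarrow> \<exists>a b. ps = a @ [x, y] @ b"
proof -
  obtain xs where xs: "set xs = X" using finite_list[OF assms] by blast
  let ?ps = "concat (map (\<lambda>(x, y). [x, y]) (List.product xs xs))"
  have "\<exists>a b. ?ps = a @ [x, y] @ b" if "x \<in> X" "y \<in> X" for x y
  proof -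
    have "(x, y) \<in> set (List.product xs xs)" using that xs by simp
    then obtain as bs where "List.product xs xs = as @ (x, y) # bs" by (meson split_list)
    then show ?thesis by auto
  qed
  moreover have "set ?ps \<subseteq> X" using xs by auto
  ultimately show ?thesis using that by blast
qed

section \<open>The coarse quarter-plane in the complex\<close>

lemma sep_complex_not_hyperbolic:
  assumes X: "finite X" "x1 \<in> X" "x2 \<in> X" "x1 \<noteq> x2"
  shows "\<not> gromov_hyperbolic (graph_points (sep_complex (free_group X))) (path_dist (sep_complex
      (free_group X)))"
proof -
  interpret group "free_group X" by (rule group_free_group)
  let ?D = "sep_complex (free_group X)" let ?cc = "conj_class (free_group X)"
  interpret connected_graph ?D using X by (intro connected_graph_sep_complex)
  obtain ps where ps: "set ps \<subseteq> X" and pairs: "\<And>x y. x \<in> X \<Longrightarrow> y \<in> X \<Longrightarrow> \<exists>a b. ps = a @ [x, y] @ b"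
    using list_of_pairs[OF X(1)] by metis
  define u where "u = positive (marker ps x1)"
  define v where "v = positive (marker ps x2)"
  define l where "l = length u"
  have lens: "length u = l" "length v = l" by (simp_all add: l_def u_def v_def positive_def
    length_marker)
  have has_pairs: "\<exists>a b. positive (marker ps z) = a @ [(x, True), (y, True)] @ b"
    if "x \<in> X" "y \<in> X" for x y z
  proof -
    obtain a b where "ps = a @ [x, y] @ b" using pairs[OF \<open>x \<in> X\<close> \<open>y \<in> X\<close>] by blast
    then have "positive (marker ps z) = positive (replicate (Suc (length ps)) z @ a) @ [(x, True),
        (y, True)] @ positive b"
      by (simp add: marker_def positive_def)
    then show ?thesis by blast
  qed
  have uF: "u \<in> carrier (free_group X)" and vF: "v \<in> carrier (free_group X)"
    using X ps unfolding u_def v_def by (auto intro!: positive_carrier simp: marker_def)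
  define Q where "Q i j = word_pow u i @ word_pow v j" for i j
  have Qpos: "Q i j = positive (word_pow (marker ps x1) i @ word_pow (marker ps x2) j)" for i j
    unfolding Q_def u_def v_def word_pow_positive positive_append ..
  have QF: "Q i j \<in> carrier (free_group X)" for i j
    unfolding Qpos using X ps by (intro positive_carrier) (auto simp: marker_def)
  have Vv: "?cc g \<in> verts ?D" if "g \<in> carrier (free_group X)" for g
    using that by (simp add: sep_complex_def)
  have dist_mult: "path_dist ?D (Vertex (?cc g)) (Vertex (?cc (g \<otimes>\<^bsub>free_group X\<^esub> w))) \<le> length w"
    if "g \<in> carrier (free_group X)" "w \<in> carrier (free_group X)" for g w
    using that by (intro path_dist_le graph_path_adjacent_pow adjacent_pow_mult[OF X(2-4)] Vv)
  have step1: "path_dist ?D (Vertex (?cc (Q i j))) (Vertex (?cc (Q (Suc i) j))) \<le> l" for i j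
  proof -
    \<comment> \<open>The new \<open>u\<close> enters on the left; up to conjugacy it can be moved
      to the right, where edges multiply.\<close>
    have "Q (Suc i) j = u @ Q i j" by (simp add: Q_def)
    then have "Q (Suc i) j = u \<otimes>\<^bsub>free_group X\<^esub> Q i j"
      using QF[of "Suc i" j] by (simp add: mult_free_group_reduced carrier_free_group)
    then have "?cc (Q (Suc i) j) = ?cc (Q i j \<otimes>\<^bsub>free_group X\<^esub> u)"
      using conj_class_commute[OF uF QF] by simp
    then show ?thesis using dist_mult[OF QF uF] lens by simp
  qed
  have step2: "path_dist ?D (Vertex (?cc (Q i j))) (Vertex (?cc (Q i (Suc j)))) \<le> l" for i j
  proof -
    have "Q i (Suc j) = Q i j @ v" by (simp add: Q_def word_pow_Suc' del: replicate_Suc)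
    then have "Q i (Suc j) = Q i j \<otimes>\<^bsub>free_group X\<^esub> v"
      using QF[of i "Suc j"] by (simp add: mult_free_group_reduced carrier_free_group)
    then show ?thesis using dist_mult[OF QF vF] lens by simp
  qed
  have lower: "real_of_int \<bar>counting w g - counting w g'\<bar>
      \<le> 27 * real l * path_dist ?D (Vertex (?cc g)) (Vertex (?cc g')) + 6 * real l"
    if w: "w = positive (marker ps z)" "length w = l" and g: "g \<in> carrier (free_group X)" "g'
        \<in> carrier (free_group X)"
    for w z g g'
  proof -
    let ?k = "vertex_dist ?D (?cc g) (?cc g')"
    have "\<bar>counting w g - counting w g'\<bar> \<le> int (27 * length w * ?k + 6 * length w)"
      using g w(1) has_pairs
      by (intro counting_adjacent_pow[OF X] adjacent_pow_vertex_dist Vv) auto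
    then have "real_of_int \<bar>counting w g - counting w g'\<bar> \<le> real_of_int (int (27 * length w * ?k +
        6 * length w))"
      by (rule of_int_le_iff[THEN iffD2])
    then show ?thesis using path_dist_vertices[OF Vv Vv] g w(2) by simp
  qed
  \<comment> \<open>The 8 is the 6 from \<open>lower\<close> plus the 2 from
    \<open>counting_marker_ge\<close>.\<close>
  have coarse: "real_of_int \<bar>a - b\<bar> \<le> 27 * real l * d + 8 * real l"
    if "\<bar>a - b\<bar> \<le> c + 2 * int l" "real_of_int c \<le> 27 * real l * d + 6 * real l" for a b c :: int
      and d :: real
    using that by linarith
  show ?thesis
  proof (rule quarter_plane_not_hyperbolic[where P = "\<lambda>i j. Vertex (?cc (Q i j))"
        and K = "real l" and C = "27 * real l"])
    show "\<exists>S. geodesic_segment (graph_points ?D) (path_dist ?D) (Vertex (?cc (Q i j))) (Vertex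
        (?cc (Q k m))) S" for i j k m
      by (intro vertex_geodesic_exists Vv QF)
    fix i j k m :: nat
    let ?d = "path_dist ?D (Vertex (?cc (Q i j))) (Vertex (?cc (Q k m)))"
    have "real_of_int \<bar>int i - int k\<bar> \<le> 27 * real l * ?d + 8 * real l"
      using counting_marker_ge(1)[OF X(4), of i k ps j m] lower[OF u_def lens(1) QF QF, of i j k m]
      by (intro coarse) (auto simp: u_def[symmetric] v_def[symmetric] Q_def lens)
    \<comment> \<open>In \<open>quarter_plane_not_hyperbolic\<close> the constant \<open>C\<close>
      is both factor and summand, so the summand is enlarged from 8 to 27 times
      \<open>real l\<close>.\<close>
    then show "\<bar>real i - real k\<bar> \<le> 27 * real l * ?d + 27 * real l" by simp
    have "real_of_int \<bar>int j - int m\<bar> \<le> 27 * real l * ?d + 8 * real l"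
      using counting_marker_ge(2)[OF X(4)[symmetric], of j m ps i k] lower[OF v_def lens(2) QF QF,
        of i j k m]
      by (intro coarse) (auto simp: u_def[symmetric] v_def[symmetric] Q_def lens)
    then show "\<bar>real j - real m\<bar> \<le> 27 * real l * ?d + 27 * real l" by simp
  qed (use path_dist_sym path_dist_triangle step1 step2 in auto)
qed

theorem theorem1p5:
  fixes n :: nat
  assumes "n \<ge> 2"
  shows "\<not> gromov_hyperbolic (graph_points (SC n)) (path_dist (SC n))"
  unfolding SC_def rose_group_def using assms
  by (intro sep_complex_not_hyperbolic[of _ 1 2]) auto

end
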